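(* Let $p(z)=a_0z^n+a_1z^{n-1}+\cdots+a_n$ and $q(z)=b_0z^n+b_1z^{n-1}+\cdots+b_n$ be polynomials with complex coefficients, $a_0\ne0$, and let $$R(z)=\frac{q(z)}{p(z)}=s_{-1}+\frac{s_0}{z}+\frac{s_1}{z^2}+\cdots$$ have exactly $r$ poles counting multiplicities, $1\le r\le n$. Put $k=2r-1$ if $R$ has a pole at $0$ and $k=2r$ otherwise, and $c_0=b_0/a_0$. The following conditions are equivalent: 1) $D_j(R)\ne 0$ for $j=1,\ldots,r$; $\widehat D_j(R)\neq 0$ for $j=1,\ldots,r-1$; $D_j(R)=\widehat D_j(R)=0$ for $j>r$; moreover $\widehat D_r(R)=0$ if and only if $R$ has a pole at $0$. 2) $R$ has a Stieltjes continued fraction expansion $$R(z)=c_0+\cfrac{1}{c_1z+\cfrac{1}{c_2+\cfrac{1}{c_3z+\cfrac{1}{\ddots+\cfrac1T}}}},\qquad c_j\ne0\ (1\le j\le k),$$ where $T=c_{2r}$ if $R$ has no pole at $0$ and $T=c_{2r-1}z$ if $R$ has a pole at $0$. 3) The Euclidean algorithm applied to $g_0(z)=p(z^2)$ and $g_1(z)=zq(z^2)-\frac{b_0}{a_0}zp(z^2)$ is regular, and $\deg q\ge n-1$. 4) There are nonzero complex numbers $c_1,\ldots,c_k$ and a (suitably normalized) greatest common divisor $g$ of $p$ and $q$ such that the infinite matrix $H(p,q)$ factors as $$H(p,q)=J(c_1)J(c_2)\cdots J(c_k)\,H(0,1)\,\mathcal T(g)\quad\text{if }\deg q<\deg p,$$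 $$H(p,q)=J(c_0)J(c_1)\cdots J(c_k)\,H(0,1)\,\mathcal T(g)\quad\text{if }\deg q=\deg p.$$ When these conditions hold, the coefficients $c_j$ in 2) and in 4) are given by $$c_{2j-1}=\frac{\widehat D_{j-1}^2(R)}{D_{j-1}(R)D_j(R)}\ (1\le j\le r),\qquad c_{2j}=-\frac{D_j^2(R)}{\widehat D_{j-1}(R)\widehat D_j(R)}\ (1\le j\le \lfloor k/2\rfloor),$$ with $D_0(R)=\widehat D_0(R)=1$, or, equivalently, in terms of the leading principal minors $\eta_j=\eta_j(p,q)$ of $H(p,q)$ (with $\eta_0=1$): if $\deg q<\deg p$, $$c_{2j-1}=\frac{\eta_{2j-1}^2}{\eta_{2j-2}\eta_{2j}}\ (1\le j\le r),\qquad c_{2j}=\frac{\eta_{2j}^2}{\eta_{2j-1}\eta_{2j+1}}\ (1\le j\le\lfloor k/2\rfloor);$$ if $\deg q=\deg p$, $$c_{2j-1}=\frac{\eta_{2j}^2}{\eta_{2j-1}\eta_{2j+1}}\ (1\le j\le r),\qquad c_{2j}=\frac{\eta_{2j+1}^2}{\eta_{2j}\eta_{2j+2}}\ (0\le j\le\lfloor k/2\rfloor).$$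
   Context: Hankel determinants: $D_j(R)=\det\|s_{i+l}\|_{i,l=0}^{j-1}$ and $\widehat D_j(R)=\det\|s_{i+l+1}\|_{i,l=0}^{j-1}$, $j\ge 1$. Regular Euclidean algorithm: for polynomials $f_0,f_1$ with $\deg f_1<\deg f_0$, write $f_{j-1}=q_jf_j+f_{j+1}$ with $q_j$ the quotient and $f_{j+1}$ the remainder of division of $f_{j-1}$ by $f_j$, until the remainder is $0$; the algorithm is regular if all quotients $q_j$ have degree exactly $1$. Set $a_i=b_i=0$ for $i<0$ and $i>n$. The infinite matrix $H(p,q)$ (rows and columns numbered from 1): if $\deg q<\deg p$ (i.e. $b_0=0$), row $2i-1$, column $c$ is $a_{c-i}$ and row $2i$, column $c$ is $b_{c-i}$ (first rows $(a_0,a_1,a_2,\ldots)$, $(0,b_1,b_2,\ldots)$, $(0,a_0,a_1,\ldots)$, $(0,0,b_1,\ldots)$, ...); if $\deg q=\deg p$ (i.e. $b_0\neq0$), row $2i-1$, column $c$ is $b_{c-i}$ and row $2i$, column $c$ is $a_{c-i-1}$ (first rows $(b_0,b_1,\ldots)$, $(0,a_0,a_1,\ldots)$, $(0,b_0,b_1,\ldots)$, $(0,0,a_0,\ldots)$, ...). For $c\in\mathbb C$, $$J(c)=\begin{pmatrix} c&1&0&0&0&\dots\\0&0&1&0&0&\dots\\0&0&c&1&0&\dots\\0&0&0&0&1&\dots\\0&0&0&0&c&\dots\\ \vdots&\vdots&\vdots&\vdots&\vdots&\ddots\end{pmatrix},$$ i.e. row $2i-1$ has $c$ in column $2i-1$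 and $1$ in column $2i$, row $2i$ has $1$ in column $2i+1$, all other entries zero. $H(0,1)$ is the infinite matrix with entry $1$ at positions $(2i-1,i)$, $i\ge1$, and $0$ elsewhere. For $g(z)=g_0z^l+g_1z^{l-1}+\cdots+g_l$, $\mathcal T(g)$ is the infinite upper triangular Toeplitz matrix whose $(i,j)$ entry is $g_{j-i}$ (with $g_i=0$ for $i<0$ or $i>l$). A greatest common divisor is determined up to a nonzero constant factor. *)

theory Defs
  imports
    "HOL-Complex_Analysis.Complex_Analysis"
    "Jordan_Normal_Form.Determinant"
begin

text \<open>
  The value of \<open>R\<close> at a zero of \<open>p\<close> is \<open>0\<close> by the convention for division, but it is never used:
  \<^const>\<open>is_pole\<close>, \<^const>\<open>zorder\<close> and the Laurent expansion at infinity only depend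
  on punctured neighbourhoods, so removable singularities do not count as poles.
\<close>

definition ratfun :: "complex poly \<Rightarrow> complex poly \<Rightarrow> complex \<Rightarrow> complex" where
  "ratfun q p = (\<lambda>z. poly q z / poly p z)"

definition pole_count :: "(complex \<Rightarrow> complex) \<Rightarrow> nat" where
  "pole_count f = (\<Sum>z | is_pole f z. nat (- zorder f z))"

text \<open>The sequence \<open>s\<close> is indexed from \<open>-1\<close>: \<open>R(z) = s (-1) + s 0 / z + s 1 / z\<^sup>2 + \<dots>\<close> near infinity.\<close>

definition laurent_at_infinity :: "(complex \<Rightarrow> complex) \<Rightarrow> (int \<Rightarrow> complex) \<Rightarrow> bool" where
  "laurent_at_infinity f s \<longleftrightarrow> (\<forall>\<^sub>F z in at_infinity. (\<lambda>m. s (int m - 1) / z ^ m) sums f z)"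

text \<open>For \<open>j = 0\<close> both determinants are those of the empty matrix, hence \<open>1\<close>.\<close>

definition hankel_det :: "(int \<Rightarrow> complex) \<Rightarrow> nat \<Rightarrow> complex" where
  "hankel_det s j = Determinant.det (Matrix.mat j j (\<lambda>(i, l). s (int i + int l)))"

definition hankel_det_hat :: "(int \<Rightarrow> complex) \<Rightarrow> nat \<Rightarrow> complex" where
  "hankel_det_hat s j = Determinant.det (Matrix.mat j j (\<lambda>(i, l). s (int i + int l + 1)))"

definition hankel_conditions :: "(complex \<Rightarrow> complex) \<Rightarrow> (int \<Rightarrow> complex) \<Rightarrow> nat \<Rightarrow> bool" where
  "hankel_conditions f s r \<longleftrightarrow>
     (\<forall>j\<in>{1..r}. hankel_det s j \<noteq> 0) \<and>
     (\<forall>j\<in>{1..r - 1}. hankel_det_hat s j \<noteq> 0) \<and>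
     (\<forall>j>r. hankel_det s j = 0 \<and> hankel_det_hat s j = 0) \<and>
     (hankel_det_hat s r = 0 \<longleftrightarrow> is_pole f 0)"

text \<open>
  \<open>stieltjes_frac c z j m\<close> is the finite continued fraction
  \<open>t\<^sub>j + 1 / (t\<^sub>j\<^sub>+\<^sub>1 + 1 / (\<dots> + 1 / t\<^sub>j\<^sub>+\<^sub>m))\<close> with \<open>t\<^sub>i = c i * z\<close> for odd \<open>i\<close> and \<open>t\<^sub>i = c i\<close> for even \<open>i\<close>.
\<close>

primrec stieltjes_frac :: "(nat \<Rightarrow> complex) \<Rightarrow> complex \<Rightarrow> nat \<Rightarrow> nat \<Rightarrow> complex" where
  "stieltjes_frac c z j 0 = (if odd j then c j * z else c j)"
| "stieltjes_frac c z j (Suc m) =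
     (if odd j then c j * z else c j) + 1 / stieltjes_frac c z (Suc j) m"

text \<open>
  Equality of rational functions is equality at all but finitely many points. If
  \<open>c 1, \<dots>, c k\<close> are nonzero, no partial denominator vanishes identically (each one behaves
  like its first term at infinity), so division by zero occurs at finitely many points only.
\<close>

definition stieltjes_expansion ::
    "complex poly \<Rightarrow> complex poly \<Rightarrow> nat \<Rightarrow> (nat \<Rightarrow> complex) \<Rightarrow> bool" where
  "stieltjes_expansion p q k c \<longleftrightarrow>
     c 0 = coeff q (degree p) / coeff p (degree p) \<and>
     (\<forall>j\<in>{1..k}. c j \<noteq> 0) \<and>
     (MOST z. ratfun q p z = stieltjes_frac c z 0 k)"

function euclid_quotients :: "complex poly \<Rightarrow> complex poly \<Rightarrow> complex poly list" where
  "euclid_quotients f g = (if g = 0 then [] else (f div g) # euclid_quotients g (f mod g))"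
  by pat_completeness auto
termination
  by (relation "Wellfounded.measure (\<lambda>(f, g). if g = 0 then 0 else Suc (degree g))")
    (auto simp: degree_mod_less')

declare euclid_quotients.simps [simp del]

definition regular_euclid :: "complex poly \<Rightarrow> complex poly \<Rightarrow> bool" where
  "regular_euclid f g \<longleftrightarrow> (\<forall>h \<in> set (euclid_quotients f g). degree h = 1)"

text \<open>
  Infinite matrices are functions of a row and a column index, both numbered from \<open>1\<close>;
  entries with an index \<open>0\<close> are irrelevant.
\<close>

type_synonym inf_mat = "nat \<Rightarrow> nat \<Rightarrow> complex"

definition inf_mat_eq :: "inf_mat \<Rightarrow> inf_mat \<Rightarrow> bool" where
  "inf_mat_eq A B \<longleftrightarrow> (\<forall>i\<ge>1. \<forall>j\<ge>1. A i j = B i j)"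

definition inf_mat_mult :: "inf_mat \<Rightarrow> inf_mat \<Rightarrow> inf_mat" where
  "inf_mat_mult A B = (\<lambda>i j. \<Sum>\<^sub>\<infinity>l\<in>{1..}. A i l * B l j)"

definition leading_minor :: "inf_mat \<Rightarrow> nat \<Rightarrow> complex" where
  "leading_minor A j = Determinant.det (Matrix.mat j j (\<lambda>(i, l). A (Suc i) (Suc l)))"

text \<open>The coefficient \<open>f\<^sub>m\<close> in \<open>f = f\<^sub>0 z\<^sup>n + f\<^sub>1 z\<^sup>n\<^sup>-\<^sup>1 + \<dots> + f\<^sub>n\<close>, and \<open>0\<close> for \<open>m < 0\<close> and \<open>m > n\<close>.\<close>

definition desc_coeff :: "nat \<Rightarrow> complex poly \<Rightarrow> int \<Rightarrow> complex" where
  "desc_coeff n f m = (if 0 \<le> m \<and> m \<le> int n then coeff f (n - nat m) else 0)"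

definition H_mat :: "complex poly \<Rightarrow> complex poly \<Rightarrow> inf_mat" where
  "H_mat p q = (\<lambda>r c.
     let a = desc_coeff (degree p) p; b = desc_coeff (degree p) q; i = (r + 1) div 2 in
       if degree q < degree p
       then if odd r then a (int c - int i) else b (int c - int i)
       else if odd r then b (int c - int i) else a (int c - int i - 1))"

definition J_mat :: "complex \<Rightarrow> inf_mat" where
  "J_mat x = (\<lambda>r c.
     if odd r \<and> c = r then x else if c = r + 1 then 1 else 0)"

definition H01_mat :: inf_mat where
  "H01_mat = (\<lambda>r c. if r + 1 = 2 * c then 1 else 0)"

definition toeplitz_mat :: "complex poly \<Rightarrow> inf_mat" where
  "toeplitz_mat g = (\<lambda>i j. desc_coeff (degree g) g (int j - int i))"

definition is_a_gcd :: "complex poly \<Rightarrow> complex poly \<Rightarrow> complex poly \<Rightarrow> bool" where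
  "is_a_gcd g p q \<longleftrightarrow> g dvd p \<and> g dvd q \<and> (\<forall>d. d dvd p \<and> d dvd q \<longrightarrow> d dvd g)"

text \<open>
  The product is bracketed to the right; all factors \<open>J(c)\<close> and \<open>H(0,1)\<close> have finitely many
  nonzero entries in each row, so all sums are finite and the bracketing is immaterial.
\<close>

definition H_factorization ::
    "complex poly \<Rightarrow> complex poly \<Rightarrow> nat \<Rightarrow> (nat \<Rightarrow> complex) \<Rightarrow> complex poly \<Rightarrow> bool" where
  "H_factorization p q k c g \<longleftrightarrow>
     c 0 = coeff q (degree p) / coeff p (degree p) \<and>
     (\<forall>j\<in>{1..k}. c j \<noteq> 0) \<and>
     is_a_gcd g p q \<and>
     inf_mat_eq (H_mat p q)
       (foldr (\<lambda>j M. inf_mat_mult (J_mat (c j)) M)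
          [(if degree q < degree p then 1 else 0)..<Suc k]
          (inf_mat_mult H01_mat (toeplitz_mat g)))"

end

theory Submission
  imports
    Defs
    "HOL-Computational_Algebra.Fundamental_Theorem_Algebra"
    "HOL-Computational_Algebra.Field_as_Ring"
begin

text \<open>
  Put \<open>t = 1 / z\<close>, \<open>P = t\<^sup>n p(1 / t)\<close> and \<open>Q = t\<^sup>n (q - c\<^sub>0 p)(1 / t)\<close>. For power series \<open>x\<close>, \<open>y\<close> in
  \<open>t\<close> let \<open>H(x, y)\<close> be the infinite matrix with the rows \<open>x, y, t x, t y, t\<^sup>2 x, \<dots>\<close>. Then
  \<open>J(c) H(x, y) = H(c x + y, t x)\<close>, so the factorization of \<open>H(p, q)\<close> says that \<open>(P, Q)\<close> arises from
  \<open>(G, 0)\<close>, with \<open>G\<close> the reversal of \<open>g\<close>, by the steps \<open>(x, y) \<mapsto> (c x + y, t x)\<close>. The same steps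
  build the S-fraction of \<open>Q / P\<close> from the inside and, after \<open>t = 1 / w\<^sup>2\<close>, run the Euclidean
  algorithm backwards. One step multiplies the leading minors of \<open>H(x, y)\<close> by \<open>(c x + y)(0)\<close> and
  shifts them by one. Hence the \<open>c\<^sub>j\<close> are quotients of minors, and the steps can be undone \<open>k\<close> times
  exactly when the first \<open>k + 1\<close> minors do not vanish. Finally
  \<open>H(P, Q) = H(1, Q / P) T\<close> with \<open>T\<close> upper triangular Toeplitz, and the leading minors of
  \<open>H(1, Q / P)\<close> are \<open>D\<^sub>j\<close> and \<open>(-1)\<^sup>j\<close> times the shifted Hankel determinants.
\<close>

section \<open>Leading minors of interlaced matrices\<close>

definition interlaced :: "complex fps \<Rightarrow> complex fps \<Rightarrow> inf_mat" where
  "interlaced x y = (\<lambda>r c. let i = (r + 1) div 2 in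
     if c < i then 0 else fps_nth (if odd r then x else y) (c - i))"

lemma leading_minor_cong:
  assumes "inf_mat_eq A B"
  shows "leading_minor A m = leading_minor B m"
proof -
  have "Matrix.mat m m (\<lambda>(i, l). A (Suc i) (Suc l)) = Matrix.mat m m (\<lambda>(i, l). B (Suc i) (Suc l))"
    using assms by (intro eq_matI) (auto simp: inf_mat_eq_def)
  then show ?thesis by (simp add: leading_minor_def)
qed

lemma leading_minor_0 [simp]: "leading_minor A 0 = 1"
  by (simp add: leading_minor_def)

text \<open>Row \<open>2i + 1\<close> of the larger matrix is \<open>t\<^sup>i (c x + y)\<close>; subtracting \<open>c\<close> times row \<open>2i\<close>, which is
  \<open>t\<^sup>i x\<close>, leaves \<open>t\<^sup>i y\<close>, so that below the first row the matrix of \<open>x\<close> and \<open>y\<close> appears, shifted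
  by one column.\<close>

lemma leading_minor_interlaced_step:
  "leading_minor (interlaced (fps_const c * x + y) (fps_X * x)) (Suc m) =
     fps_nth (fps_const c * x + y) 0 * leading_minor (interlaced x y) m"
proof -
  let ?H = "interlaced (fps_const c * x + y) (fps_X * x)" and ?N = "interlaced x y"
  define A where "A = Matrix.mat (Suc m) (Suc m) (\<lambda>(i, l). ?H (Suc i) (Suc l))"
  \<comment> \<open>Rows and columns count from 0 here and from 1 in \<open>?H\<close> and
    \<open>?N\<close>. The first column of \<open>B\<close> is zero below its top entry, so
    expanding along it leaves a leading block of \<open>?N\<close>.\<close>
  define B where "B = Matrix.mat (Suc m) (Suc m) (\<lambda>(i, l).
    if i = 0 then ?H 1 (Suc l) else if l = 0 then 0 else ?N i l)"
  \<comment> \<open>Unit lower triangular: it adds \<open>c\<close> times the preceding row to every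
    even row other than row 0, reversing the row subtractions.\<close>
  define L where "L = Matrix.mat (Suc m) (Suc m) (\<lambda>(i, l).
    if l = i then 1 else if even i \<and> Suc l = i then c else 0)"
  have carr: "A \<in> carrier_mat (Suc m) (Suc m)" "B \<in> carrier_mat (Suc m) (Suc m)"
    "L \<in> carrier_mat (Suc m) (Suc m)"
    by (simp_all add: A_def B_def L_def)
  have "A = L * B"
  proof (rule eq_matI)
    fix i l assume il: "i < dim_row (L * B)" "l < dim_col (L * B)"
    then have i: "i < Suc m" and l: "l < Suc m" by (simp_all add: L_def B_def)
    have "(L * B) $$ (i, l) = (\<Sum>a<Suc m. L $$ (i, a) * B $$ (a, l))"
      using il carr i l by (simp add: scalar_prod_def lessThan_atLeast0)
    also have "\<dots> = (\<Sum>a<Suc m. (if a = i then B $$ (i, l) else 0) +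
        (if even i \<and> i > 0 \<and> a = i - 1 then c * B $$ (i - 1, l) else 0))"
      using i by (intro sum.cong) (auto simp: L_def)
    also have "\<dots> = B $$ (i, l) + (if even i \<and> i > 0 then c * B $$ (i - 1, l) else 0)"
      using i by (auto simp: sum.distrib)
    also have "\<dots> = A $$ (i, l)"
    proof (cases i)
      case 0
      then show ?thesis using l by (simp add: A_def B_def)
    next
      case (Suc a)
      show ?thesis
      proof (cases "odd a")
        case True
        then obtain b where "a = 2 * b + 1" by (elim oddE)
        then show ?thesis using i l Suc
          by (auto simp: A_def B_def interlaced_def Let_def Suc_diff_le)
      next
        case False
        then obtain b where "a = 2 * b" by auto
        then show ?thesis using i l Suc
          by (cases l) (auto simp: A_def B_def interlaced_def Let_def)
      qed
    qed
    finally show "A $$ (i, l) = (L * B) $$ (i, l)" by simp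
  qed (simp_all add: A_def B_def L_def)
  then have "det A = det L * det B" using carr by (simp add: det_mult)
  also have "det L = 1"
    by (subst det_lower_triangular[OF _ carr(3)])
      (auto simp: L_def prod_list_diag_prod)
  also have "det B = (\<Sum>i<Suc m. B $$ (i, 0) * cofactor B i 0)"
    by (rule laplace_expansion_column[OF carr(2)]) simp
  also have "\<dots> = B $$ (0, 0) * cofactor B 0 0"
    by (subst sum.lessThan_Suc_shift) (auto simp: B_def)
  also have "mat_delete B 0 0 = Matrix.mat m m (\<lambda>(i, l). ?N (Suc i) (Suc l))"
    by (rule eq_matI) (auto simp: mat_delete_def B_def)
  then have "cofactor B 0 0 = leading_minor ?N m"
    by (simp add: cofactor_def leading_minor_def)
  also have "B $$ (0, 0) = fps_nth (fps_const c * x + y) 0"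
    by (simp add: B_def interlaced_def)
  finally show ?thesis by (simp add: leading_minor_def A_def)
qed

text \<open>Multiplying all rows by \<open>u\<close> is right multiplication by the upper triangular
  Toeplitz matrix of \<open>u\<close>. Triangularity lets this restrict to leading blocks, and every
  diagonal entry is \<open>fps_nth u 0\<close>.\<close>

lemma leading_minor_interlaced_mult:
  "leading_minor (interlaced (x * u) (y * u)) m =
     fps_nth u 0 ^ m * leading_minor (interlaced x y) m"
proof -
  define A where "A = Matrix.mat m m (\<lambda>(i, l). interlaced (x * u) (y * u) (Suc i) (Suc l))"
  define B where "B = Matrix.mat m m (\<lambda>(i, l). interlaced x y (Suc i) (Suc l))"
  define U where "U = Matrix.mat m m (\<lambda>(i, l). if l < i then 0 else fps_nth u (l - i))"
  have carr: "A \<in> carrier_mat m m" "B \<in> carrier_mat m m" "U \<in> carrier_mat m m"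
    by (simp_all add: A_def B_def U_def)
  have "A = B * U"
  proof (rule eq_matI)
    fix i l assume il: "i < dim_row (B * U)" "l < dim_col (B * U)"
    then have i: "i < m" and l: "l < m" by (simp_all add: B_def U_def)
    define d where "d = (Suc i + 1) div 2 - 1"
    have d: "(Suc i + 1) div 2 = Suc d" by (simp add: d_def)
    define w where "w = (if odd (Suc i) then x else y)"
    have "(B * U) $$ (i, l) = (\<Sum>a<m. B $$ (i, a) * U $$ (a, l))"
      using il carr i l by (simp add: scalar_prod_def lessThan_atLeast0)
    also have "\<dots> = (\<Sum>a<m. if d \<le> a \<and> a \<le> l then fps_nth w (a - d) * fps_nth u (l - a) else 0)"
      using i l d by (intro sum.cong) (auto simp: B_def U_def interlaced_def w_def Let_def)
    also have "\<dots> = (\<Sum>a\<in>{d..l}. fps_nth w (a - d) * fps_nth u (l - a))"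
      using l by (intro sum.mono_neutral_cong_right) auto
    also have "\<dots> = (if l < d then 0 else fps_nth (w * u) (l - d))"
    proof (cases "l < d")
      case False
      have "(\<Sum>a\<in>{d..l}. fps_nth w (a - d) * fps_nth u (l - a)) =
          (\<Sum>a\<in>{0..l - d}. fps_nth w a * fps_nth u (l - d - a))"
        using False by (intro sum.reindex_bij_witness[of _ "\<lambda>a. a + d" "\<lambda>a. a - d"])
          (auto simp: algebra_simps)
      then show ?thesis using False by (simp add: fps_mult_nth)
    qed simp
    also have "\<dots> = A $$ (i, l)"
      using i l d by (auto simp: A_def interlaced_def w_def Let_def)
    finally show "A $$ (i, l) = (B * U) $$ (i, l)" by simp
  qed (simp_all add: A_def B_def U_def)
  then have "det A = det B * det U" using carr by (simp add: det_mult)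
  also have "det U = prod_list (diag_mat U)"
    by (rule det_upper_triangular[OF _ carr(3)]) (auto simp: U_def)
  also have "\<dots> = fps_nth u 0 ^ m"
    by (simp add: U_def prod_list_diag_prod)
  finally show ?thesis by (simp add: leading_minor_def A_def B_def)
qed

text \<open>Interpolates between the Hankel matrices and the leading blocks of the interlaced matrix of
  \<open>1\<close> and \<open>s\<^sub>0 t + s\<^sub>1 t\<^sup>2 + \<dots>\<close>: \<open>i\<close> Hankel rows on top, followed by \<open>m\<close> rows of the interlaced
  matrix.\<close>

definition hankel_interlaced :: "(int \<Rightarrow> complex) \<Rightarrow> nat \<Rightarrow> nat \<Rightarrow> complex mat" where
  "hankel_interlaced s i m = Matrix.mat (i + m) (i + m) (\<lambda>(a, l).
     if a < i then s (int a + int l)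
     else if even (a - i) then (if l = (a - i) div 2 then 1 else 0)
     else if l \<le> (a - i) div 2 then 0 else s (int l - int ((a - i) div 2) - 1))"

lemma det_unit_row:
  fixes A :: "complex mat"
  assumes A: "A \<in> carrier_mat (Suc n) (Suc n)" and i: "i < Suc n"
    and row: "\<And>l. l < Suc n \<Longrightarrow> A $$ (i, l) = (if l = 0 then 1 else 0)"
  shows "det A = (-1) ^ i * det (mat_delete A i 0)"
proof -
  have "det A = (\<Sum>l<Suc n. A $$ (i, l) * cofactor A i l)"
    by (rule laplace_expansion_row[OF A i])
  also have "\<dots> = (\<Sum>l<Suc n. if l = 0 then cofactor A i 0 else 0)"
    using row by (intro sum.cong) auto
  finally show ?thesis by (simp add: cofactor_def)
qed

text \<open>The only interlaced row is the unit vector of column 0. Removing it together with that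
  column shifts every Hankel row by one index.\<close>

lemma det_hankel_interlaced_1:
  "det (hankel_interlaced s i 1) = (-1) ^ i * hankel_det_hat s i"
proof -
  have "mat_delete (hankel_interlaced s i 1) i 0 =
      Matrix.mat i i (\<lambda>(a, l). s (int a + int l + 1))"
    by (rule eq_matI) (auto simp: mat_delete_def hankel_interlaced_def algebra_simps)
  then show ?thesis
    using det_unit_row[of "hankel_interlaced s i 1" i i]
    by (simp add: hankel_det_hat_def) (simp add: hankel_interlaced_def)
qed

text \<open>The first interlaced row is a unit vector. Expanding along it deletes column 0, so the
  Hankel rows lose their first entries and the next row becomes \<open>s 0, s 1, ...\<close>. Moved
  to the top, that row is the new first Hankel row, and the sign of the move cancels the sign of the
  expansion.\<close>

lemma det_hankel_interlaced_Suc_Suc: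
  "det (hankel_interlaced s i (Suc (Suc m))) = det (hankel_interlaced s (Suc i) m)"
proof -
  let ?A = "hankel_interlaced s i (Suc (Suc m))"
  define B where "B = mat_delete ?A i 0"
  have B: "B \<in> carrier_mat (Suc (i + m)) (Suc (i + m))"
    by (simp add: B_def mat_delete_def hankel_interlaced_def)
  have "det ?A = (-1) ^ i * det B"
    unfolding B_def by (rule det_unit_row[of _ "i + Suc m"]) (auto simp: hankel_interlaced_def)
  also have "\<dots> = det (swap_row_to_front B i)"
    by (rule swap_row_to_front_det[OF B, symmetric]) simp
  also have "swap_row_to_front B i = hankel_interlaced s (Suc i) m"
  proof (subst swap_row_to_front_result[OF B], simp, rule eq_matI, goal_cases)
    case (1 a l)
    then have a: "a < Suc (i + m)" and l: "l < Suc (i + m)"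
      by (simp_all add: hankel_interlaced_def)
    consider "a = 0" | "0 < a" "a \<le> i" | "i < a" by linarith
    then show ?case
    proof cases
      case 3
      then obtain b where b: "a = Suc (i + b)" by (metis add_Suc less_imp_Suc_add)
      show ?thesis
      proof (cases "even b")
        case True
        then obtain d where "b = 2 * d" by (elim evenE)
        then show ?thesis using a l B b
          by (auto simp: B_def mat_delete_def hankel_interlaced_def)
      next
        case False
        then obtain d where "b = 2 * d + 1" by (elim oddE)
        then show ?thesis using a l B b
          by (auto simp: B_def mat_delete_def hankel_interlaced_def)
      qed
    qed (use a l B in \<open>auto simp: B_def mat_delete_def hankel_interlaced_def algebra_simps of_nat_diff\<close>)
  qed (use B in \<open>auto simp: hankel_interlaced_def\<close>)
  finally show ?thesis .
qed

text \<open>Each pair of interlaced rows turns into one Hankel row; a single row left over at the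
  end produces the shifted Hankel determinant and the sign.\<close>

lemma det_hankel_interlaced:
  "det (hankel_interlaced s i (2 * j)) = hankel_det s (i + j)"
  "det (hankel_interlaced s i (Suc (2 * j))) = (-1) ^ (i + j) * hankel_det_hat s (i + j)"
proof -
  have "det (hankel_interlaced s i 0) = hankel_det s i" for i
    unfolding hankel_det_def
    by (rule arg_cong[of _ _ det], rule eq_matI) (auto simp: hankel_interlaced_def)
  then show "det (hankel_interlaced s i (2 * j)) = hankel_det s (i + j)"
    by (induction j arbitrary: i) (simp_all add: det_hankel_interlaced_Suc_Suc)
  show "det (hankel_interlaced s i (Suc (2 * j))) = (-1) ^ (i + j) * hankel_det_hat s (i + j)"
    using det_hankel_interlaced_1[of s]
    by (induction j arbitrary: i) (simp_all add: det_hankel_interlaced_Suc_Suc)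
qed

lemma leading_minor_interlaced_one:
  assumes "fps_nth F 0 = 0" "\<And>m. fps_nth F (Suc m) = s (int m)"
  shows "leading_minor (interlaced 1 F) (2 * j) = hankel_det s j"
    and "leading_minor (interlaced 1 F) (Suc (2 * j)) = (-1) ^ j * hankel_det_hat s j"
proof -
  have "leading_minor (interlaced 1 F) m = det (hankel_interlaced s 0 m)" for m
    unfolding leading_minor_def
  proof (rule arg_cong[of _ _ det], rule eq_matI, goal_cases)
    case (1 a l)
    have F: "fps_nth F (l - d) = s (int l - int d - 1)" if "d < l" for d
    proof -
      have "l - d = Suc (l - d - 1)" "int (l - d - 1) = int l - int d - 1" using that by linarith+
      then show ?thesis using assms(2)[of "l - d - 1"] by metis
    qed
    show ?case
    proof (cases "even a")
      case True
      then obtain d where "a = 2 * d" by (elim evenE)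
      then show ?thesis using 1 by (auto simp: hankel_interlaced_def interlaced_def Let_def)
    next
      case False
      then obtain d where "a = 2 * d + 1" by (elim oddE)
      then show ?thesis using 1 F assms(1)
        by (auto simp: hankel_interlaced_def interlaced_def Let_def le_less)
    qed
  qed (auto simp: hankel_interlaced_def)
  then show "leading_minor (interlaced 1 F) (2 * j) = hankel_det s j"
    "leading_minor (interlaced 1 F) (Suc (2 * j)) = (-1) ^ j * hankel_det_hat s j"
    using det_hankel_interlaced[of s 0 j] by simp_all
qed

section \<open>S-fraction steps\<close>

definition rev_poly :: "nat \<Rightarrow> complex poly \<Rightarrow> complex poly" where
  "rev_poly n p = Poly (map (\<lambda>i. coeff p (n - i)) [0..<Suc n])"

lemma coeff_rev_poly: "coeff (rev_poly n p) i = (if i \<le> n then coeff p (n - i) else 0)"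
  by (auto simp: rev_poly_def coeff_Poly_eq nth_default_def simp del: upt_Suc)

lemma poly_rev_poly_0: "poly (rev_poly n p) 0 = coeff p n"
  by (simp add: poly_0_coeff_0 coeff_rev_poly)

lemma poly_sum_atMost:
  fixes p :: "complex poly"
  assumes "degree p \<le> n"
  shows "poly p z = (\<Sum>i\<le>n. coeff p i * z ^ i)"
  by (subst poly_as_sum_of_monoms'[OF assms, symmetric]) (simp add: poly_sum poly_monom)

lemma poly_rev_poly:
  assumes "degree p \<le> n" "z \<noteq> 0"
  shows "poly (rev_poly n p) z = z ^ n * poly p (1 / z)"
proof -
  have "degree (rev_poly n p) \<le> n"
    by (rule degree_le) (simp add: coeff_rev_poly)
  then have "poly (rev_poly n p) z = (\<Sum>i\<le>n. coeff (rev_poly n p) i * z ^ i)"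
    by (rule poly_sum_atMost)
  also have "\<dots> = (\<Sum>i\<le>n. coeff p (n - i) * z ^ i)"
    by (intro sum.cong) (simp_all add: coeff_rev_poly)
  also have "\<dots> = (\<Sum>i\<le>n. coeff p i * z ^ (n - i))"
    by (intro sum.reindex_bij_witness[of _ "\<lambda>i. n - i" "\<lambda>i. n - i"]) auto
  also have "\<dots> = (\<Sum>i\<le>n. z ^ n * (coeff p i * (1 / z) ^ i))"
    using assms(2) by (intro sum.cong) (auto simp: power_diff power_divide)
  also have "\<dots> = z ^ n * poly p (1 / z)"
    using assms(1) by (simp add: poly_sum_atMost[of p n] sum_distrib_left)
  finally show ?thesis .
qed

lemma poly_eq_off_0:
  fixes p q :: "complex poly"
  assumes "\<And>z. z \<noteq> 0 \<Longrightarrow> poly p z = poly q z"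
  shows "p = q"
proof -
  \<comment> \<open>Multiplication by the variable forces agreement at 0 as well.\<close>
  have "pCons 0 p = pCons 0 q"
    by (rule poly_ext) (use assms in auto)
  then show ?thesis by simp
qed

lemma rev_poly_mult:
  assumes "degree p \<le> m" "degree q \<le> n"
  shows "rev_poly (m + n) (p * q) = rev_poly m p * rev_poly n q"
proof (rule poly_eq_off_0)
  fix z :: complex assume "z \<noteq> 0"
  moreover have "degree (p * q) \<le> m + n"
    using degree_mult_le[of p q] assms by linarith
  ultimately show "poly (rev_poly (m + n) (p * q)) z = poly (rev_poly m p * rev_poly n q) z"
    using assms by (simp add: poly_rev_poly power_add)
qed

lemma rev_poly_diff: "rev_poly n (p - q) = rev_poly n p - rev_poly n q"
  by (rule poly_eqI) (simp add: coeff_rev_poly)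

lemma rev_poly_smult: "rev_poly n (Polynomial.smult c p) = Polynomial.smult c (rev_poly n p)"
  by (rule poly_eqI) (simp add: coeff_rev_poly)

text \<open>In the variable \<open>t = 1 / z\<close> this is one step \<open>x / (y / t) = c + t / (x' / (y' / t))\<close>, the
  pair \<open>(x, y)\<close> being the image of \<open>(x', y')\<close>, of an S-fraction read from the inside.\<close>

definition sfrac_step :: "complex \<Rightarrow> complex poly \<times> complex poly \<Rightarrow> complex poly \<times> complex poly" where
  "sfrac_step c = (\<lambda>(x, y). (Polynomial.smult c x + y, pCons 0 x))"

lemma sfrac_step_Pair [simp]: "sfrac_step c (x, y) = (Polynomial.smult c x + y, pCons 0 x)"
  by (simp add: sfrac_step_def)

section \<open>Pairs built up by S-fraction steps\<close>

definition sfrac_pair :: "complex list \<Rightarrow> complex poly \<Rightarrow> complex poly \<times> complex poly" where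
  "sfrac_pair cs g = foldr sfrac_step cs (g, 0)"

lemma sfrac_pair_Nil [simp]: "sfrac_pair [] g = (g, 0)"
  and sfrac_pair_Cons [simp]: "sfrac_pair (c # cs) g = sfrac_step c (sfrac_pair cs g)"
  by (simp_all add: sfrac_pair_def)

text \<open>Every step is linear over the polynomial ring, so a factor of the innermost polynomial
  passes through. This is how the common divisor is split off.\<close>

lemma sfrac_pair_mult:
  "sfrac_pair cs (g * u) = (fst (sfrac_pair cs g) * u, snd (sfrac_pair cs g) * u)"
  by (induction cs) (auto simp: sfrac_step_def case_prod_beta algebra_simps)

lemma poly_sfrac_pair_0:
  "poly (fst (sfrac_pair cs g)) 0 = prod_list cs * poly g 0" "poly (snd (sfrac_pair cs g)) 0 = 0"
  by (induction cs) (auto simp: sfrac_step_def case_prod_beta)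

text \<open>Away from 0 each step acts invertibly on the values; at 0 the first component is the
  product of the coefficients.\<close>

lemma sfrac_pair_no_common_root:
  assumes "0 \<notin> set cs"
  shows "poly (fst (sfrac_pair cs 1)) z \<noteq> 0 \<or> poly (snd (sfrac_pair cs 1)) z \<noteq> 0"
proof (cases "z = 0")
  case True
  then show ?thesis using assms by (simp add: poly_sfrac_pair_0 prod_list_zero_iff)
next
  case False
  then show ?thesis by (induction cs) (auto simp: sfrac_step_def case_prod_beta)
qed

section \<open>Leading minors of pairs and the recovery of the coefficients\<close>

definition pair_minor :: "complex poly \<times> complex poly \<Rightarrow> nat \<Rightarrow> complex" where
  "pair_minor w = leading_minor (interlaced (fps_of_poly (fst w)) (fps_of_poly (snd w)))"

lemma pair_minor_0 [simp]: "pair_minor w 0 = 1"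
  by (simp add: pair_minor_def)

lemma pair_minor_sfrac_step:
  "pair_minor (sfrac_step c w) (Suc m) = poly (fst (sfrac_step c w)) 0 * pair_minor w m"
  using leading_minor_interlaced_step[of c "fps_of_poly (fst w)" "fps_of_poly (snd w)" m]
  by (simp add: pair_minor_def sfrac_step_def case_prod_beta fps_of_poly_add fps_of_poly_smult
      fps_of_poly_pCons poly_0_coeff_0 mult.commute[of _ fps_X])

lemma pair_minor_1: "pair_minor w (Suc 0) = poly (fst w) 0"
  by (simp add: pair_minor_def leading_minor_def det_single interlaced_def poly_0_coeff_0)

lemma pair_minor_snd_0: "pair_minor (g, 0) (Suc (Suc m)) = 0"
proof -
  define A where "A = Matrix.mat (Suc (Suc m)) (Suc (Suc m))
    (\<lambda>(i, l). interlaced (fps_of_poly g) 0 (Suc i) (Suc l))"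
  have "det A = (\<Sum>j<Suc (Suc m). A $$ (1, j) * cofactor A 1 j)"
    by (rule laplace_expansion_row) (simp_all add: A_def)
  also have "\<dots> = 0"
    by (intro sum.neutral) (simp add: A_def interlaced_def)
  finally show ?thesis by (simp add: pair_minor_def leading_minor_def A_def)
qed

text \<open>Each step shifts the minors by one index and multiplies them by a nonzero constant term,
  so \<open>(g, 0)\<close> decides: there the minors of order 0 and 1 are \<open>1\<close> and
  \<open>g(0)\<close>, and all later ones vanish with the second row.\<close>

lemma pair_minor_sfrac_pair:
  assumes "0 \<notin> set cs" "poly g 0 \<noteq> 0"
  shows "pair_minor (sfrac_pair cs g) m \<noteq> 0 \<longleftrightarrow> m \<le> Suc (length cs)"
proof (use assms in \<open>induction cs arbitrary: m\<close>)
  case Nil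
  show ?case
  proof (cases m)
    case (Suc l)
    then show ?thesis using assms by (cases l) (simp_all add: pair_minor_1 pair_minor_snd_0)
  qed simp
next
  case (Cons c cs)
  show ?case
  proof (cases m)
    case (Suc l)
    then show ?thesis
      using Cons poly_sfrac_pair_0(1)[of "c # cs" g]
      by (auto simp add: pair_minor_sfrac_step prod_list_zero_iff)
  qed simp
qed

text \<open>The quotient is homogeneous of degree 0, so the factor contributed by an outer step
  cancels and only the index shifts. For \<open>j = 0\<close> the three minors are \<open>1\<close>,
  \<open>c x(0)\<close> and \<open>c x(0)^2\<close>, where \<open>x\<close> is the first component
  of the inner pair.\<close>

lemma sfrac_pair_coefficient:
  assumes "0 \<notin> set cs" "poly g 0 \<noteq> 0" "j < length cs"
  defines "\<eta> \<equiv> pair_minor (sfrac_pair cs g)"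
  shows "cs ! j = (\<eta> (Suc j))\<^sup>2 / (\<eta> j * \<eta> (Suc (Suc j)))"
  unfolding \<eta>_def
  using assms(1-3)
proof (induction cs arbitrary: j)
  case (Cons c cs)
  let ?a = "poly (fst (sfrac_pair (c # cs) g)) 0"
  have a: "?a \<noteq> 0" "?a = c * poly (fst (sfrac_pair cs g)) 0"
    using Cons.prems unfolding poly_sfrac_pair_0 by (auto simp: prod_list_zero_iff)
  show ?case
  proof (cases j)
    case 0
    then show ?thesis using a
      by (simp add: pair_minor_sfrac_step pair_minor_1 power2_eq_square)
  next
    case (Suc i)
    then show ?thesis using Cons a
      by (simp add: pair_minor_sfrac_step power2_eq_square)
  qed
qed simp

text \<open>The numbers \<open>a\<close> and \<open>b\<close> bound how many coefficients
  \<open>x\<close> and \<open>y\<close> have. Undoing a step replaces \<open>(a, b)\<close> by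
  \<open>(b, a - 1)\<close>, which keeps the bounds balanced, and after \<open>k\<close> steps a
  nonzero constant is left.\<close>

lemma sfrac_pair_exists:
  assumes "\<And>i. i \<ge> a \<Longrightarrow> coeff x i = 0" "\<And>i. i \<ge> b \<Longrightarrow> coeff y i = 0"
    and "a + b = Suc k" "b \<le> a" "a \<le> Suc b"
    and "\<And>j. j \<le> Suc k \<Longrightarrow> pair_minor (x, pCons 0 y) j \<noteq> 0"
  shows "\<exists>cs \<kappa>. length cs = k \<and> 0 \<notin> set cs \<and> \<kappa> \<noteq> 0 \<and> sfrac_pair cs [:\<kappa>:] = (x, pCons 0 y)"
  using assms
proof (induction k arbitrary: a b x y)
  case 0
  then have ab: "a = 1" "b = 0" by simp_all
  have "y = 0" using 0(2) ab by (intro poly_eqI) simp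
  moreover have "x = [:coeff x 0:]"
    using 0(1) ab by (intro poly_eqI) (auto simp: coeff_pCons split: nat.splits)
  moreover have "coeff x 0 \<noteq> 0"
    using 0(6)[of 1] by (simp add: pair_minor_1 poly_0_coeff_0)
  ultimately show ?case
    by (intro exI[of _ "[]"] exI[of _ "coeff x 0"]) simp
next
  case (Suc k)
  \<comment> \<open>This value makes the constant term of \<open>x - c y\<close> vanish, since the
    second component of a pair has to be divisible by the variable.\<close>
  define c where "c = coeff x 0 / coeff y 0"
  obtain v where v: "x - Polynomial.smult c y = pCons (coeff (x - Polynomial.smult c y) 0) v"
    by (metis coeff_pCons_0 pCons_cases)
  have x0: "coeff x 0 \<noteq> 0"
    using Suc.prems(6)[of 1] by (simp add: pair_minor_1 poly_0_coeff_0)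
  have step: "(x, pCons 0 y) = sfrac_step d (y, x - Polynomial.smult d y)" for d by simp
  \<comment> \<open>Undoing a step with coefficient 0 gives \<open>(y, x)\<close>, which suffices to
    compute this minor before \<open>coeff y 0\<close> is known to be nonzero.\<close>
  have "pair_minor (x, pCons 0 y) (Suc (Suc 0)) = coeff x 0 * coeff y 0"
    by (subst step[of 0], subst pair_minor_sfrac_step) (simp add: pair_minor_1 poly_0_coeff_0)
  then have y0: "coeff y 0 \<noteq> 0"
    using Suc.prems(6)[of 2] by (auto simp: numeral_2_eq_2)
  have v': "x - Polynomial.smult c y = pCons 0 v"
    using v y0 by (simp add: c_def)
  have xv: "(x, pCons 0 y) = sfrac_step c (y, pCons 0 v)"
    using step[of c] v' by simp
  have "\<exists>cs \<kappa>. length cs = k \<and> 0 \<notin> set cs \<and> \<kappa> \<noteq> 0 \<and> sfrac_pair cs [:\<kappa>:] = (y, pCons 0 v)"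
  proof (rule Suc.IH[of b _ "a - 1"])
    show "coeff y i = 0" if "b \<le> i" for i using Suc.prems(2) that by simp
    show "coeff v i = 0" if "a - 1 \<le> i" for i
    proof -
      have "coeff v i = coeff (x - Polynomial.smult c y) (Suc i)" by (simp add: v')
      then show ?thesis using Suc.prems(1)[of "Suc i"] Suc.prems(2)[of "Suc i"] Suc.prems(4) that by simp
    qed
    show "pair_minor (y, pCons 0 v) j \<noteq> 0" if "j \<le> Suc k" for j
      using Suc.prems(6)[of "Suc j"] that unfolding xv pair_minor_sfrac_step by simp
  qed (use Suc.prems(3-5) in auto)
  then obtain cs \<kappa> where "length cs = k" "0 \<notin> set cs" "\<kappa> \<noteq> 0" "sfrac_pair cs [:\<kappa>:] = (y, pCons 0 v)"
    by blast
  then show ?case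
    using xv x0 y0 by (intro exI[of _ "c # cs"] exI[of _ \<kappa>]) (auto simp: c_def simp del: sfrac_step_Pair)
qed

section \<open>The infinite matrices of the factorization\<close>

lemma inf_mat_mult_J:
  assumes "r \<ge> 1"
  shows "inf_mat_mult (J_mat c) M r l = (if odd r then c * M r l else 0) + M (Suc r) l"
proof -
  have "inf_mat_mult (J_mat c) M r l = (\<Sum>\<^sub>\<infinity>a\<in>{r, Suc r}. J_mat c r a * M a l)"
    unfolding inf_mat_mult_def using assms
    by (intro infsum_cong_neutral) (auto simp: J_mat_def)
  then show ?thesis by (simp add: J_mat_def)
qed

lemma inf_mat_mult_H01:
  assumes "r \<ge> 1"
  shows "inf_mat_mult H01_mat M r l = (if odd r then M ((r + 1) div 2) l else 0)"
proof -
  have "inf_mat_mult H01_mat M r l = (\<Sum>\<^sub>\<infinity>a\<in>{(r + 1) div 2}. H01_mat r a * M a l)"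
    unfolding inf_mat_mult_def using assms
    by (intro infsum_cong_neutral) (auto simp: H01_mat_def)
  then show ?thesis using assms by (auto simp: H01_mat_def elim!: oddE evenE)
qed

lemma inf_mat_mult_J_interlaced:
  assumes "inf_mat_eq M (interlaced x y)"
  shows "inf_mat_eq (inf_mat_mult (J_mat c) M) (interlaced (fps_const c * x + y) (fps_X * x))"
  unfolding inf_mat_eq_def
proof (intro allI impI)
  fix r l :: nat assume r: "1 \<le> r" and l: "1 \<le> l"
  have "inf_mat_mult (J_mat c) M r l =
      (if odd r then c * interlaced x y r l else 0) + interlaced x y (Suc r) l"
    using assms r l by (simp add: inf_mat_mult_J inf_mat_eq_def)
  also have "\<dots> = interlaced (fps_const c * x + y) (fps_X * x) r l"
  proof (cases "odd r")
    case True
    then obtain d where "r = 2 * d + 1" by (elim oddE)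
    then show ?thesis by (auto simp: interlaced_def Let_def)
  next
    case False
    then obtain d where "r = 2 * d" by auto
    then show ?thesis using l by (auto simp: interlaced_def Let_def)
  qed
  finally show "inf_mat_mult (J_mat c) M r l = interlaced (fps_const c * x + y) (fps_X * x) r l" .
qed

lemma desc_coeff_eq:
  "desc_coeff n p (int l - int i) = (if l < i then 0 else coeff (rev_poly n p) (l - i))"
  by (auto simp: desc_coeff_def coeff_rev_poly nat_diff_distrib' of_nat_diff)

lemma inf_mat_mult_H01_toeplitz:
  "inf_mat_eq (inf_mat_mult H01_mat (toeplitz_mat g)) (interlaced (fps_of_poly (rev_poly (degree g) g)) 0)"
  by (auto simp: inf_mat_eq_def inf_mat_mult_H01 toeplitz_mat_def desc_coeff_eq interlaced_def Let_def)

lemma foldr_J_interlaced: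
  assumes "inf_mat_eq M (interlaced (fps_of_poly (fst w)) (fps_of_poly (snd w)))"
  shows "inf_mat_eq (foldr (\<lambda>j. inf_mat_mult (J_mat (c j))) js M)
    (interlaced (fps_of_poly (fst (foldr sfrac_step (map c js) w)))
      (fps_of_poly (snd (foldr sfrac_step (map c js) w))))"
proof (induction js)
  case (Cons j js)
  then show ?case
    using inf_mat_mult_J_interlaced[OF Cons, of "c j"]
    by (simp add: sfrac_step_def case_prod_beta fps_of_poly_add fps_of_poly_smult fps_of_poly_pCons
        mult.commute[of _ fps_X])
qed (simp add: assms)

lemma inf_mat_eq_interlaced_iff:
  "inf_mat_eq (interlaced x y) (interlaced x' y') \<longleftrightarrow> x = x' \<and> y = y'"
proof
  assume eq: "inf_mat_eq (interlaced x y) (interlaced x' y')"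
  have "fps_nth x i = fps_nth x' i" "fps_nth y i = fps_nth y' i" for i
    using eq[unfolded inf_mat_eq_def, rule_format, of 1 "Suc i"]
      eq[unfolded inf_mat_eq_def, rule_format, of 2 "Suc i"]
    by (simp_all add: interlaced_def)
  then show "x = x' \<and> y = y'" by (simp add: fps_eq_iff)
qed (simp add: inf_mat_eq_def)

text \<open>For equal degrees the second row is \<open>0, a_0, a_1, ...\<close>, so the reversal of
  \<open>p\<close> enters with an extra factor \<open>t\<close>.\<close>

lemma H_mat_interlaced:
  "inf_mat_eq (H_mat p q)
    (if degree q < degree p
     then interlaced (fps_of_poly (rev_poly (degree p) p)) (fps_of_poly (rev_poly (degree p) q))
     else interlaced (fps_of_poly (rev_poly (degree p) q)) (fps_X * fps_of_poly (rev_poly (degree p) p)))"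
proof -
  have *: "desc_coeff n p (int l - int i - 1) =
      (if l < i then 0 else fps_nth (fps_X * fps_of_poly (rev_poly n p)) (l - i))" for n p l i
    using desc_coeff_eq[of n p l "Suc i"] by (auto simp: algebra_simps)
  have **: "desc_coeff n p (int l - (1 + int i)) =
      (if l < Suc i then 0 else coeff (rev_poly n p) (l - Suc i))" for n p l i
    using desc_coeff_eq[of n p l "Suc i"] by simp
  show ?thesis
    by (auto simp: inf_mat_eq_def H_mat_def interlaced_def Let_def * ** desc_coeff_eq)
qed

section \<open>The Euclidean algorithm\<close>

text \<open>A division with quotient \<open>c z\<close> read backwards, from
  \<open>(f_j, f_(j+1))\<close> to \<open>(f_(j-1), f_j)\<close>.\<close>

definition euclid_step :: "complex \<Rightarrow> complex poly \<times> complex poly \<Rightarrow> complex poly \<times> complex poly" where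
  "euclid_step c = (\<lambda>(u, v). ([:0, c:] * u + v, u))"

definition euclid_pair :: "complex list \<Rightarrow> complex poly \<Rightarrow> complex poly \<times> complex poly" where
  "euclid_pair cs h = foldr euclid_step cs (h, 0)"

lemma euclid_pair_Nil [simp]: "euclid_pair [] h = (h, 0)"
  and euclid_pair_Cons [simp]: "euclid_pair (c # cs) h = euclid_step c (euclid_pair cs h)"
  by (simp_all add: euclid_pair_def)

lemma div_mod_step:
  fixes a b u v :: "complex poly"
  assumes "u \<noteq> 0" "v = 0 \<or> degree v < degree u"
  shows "(a * u + v) div u = a" "(a * u + v) mod u = v"
  using assms div_poly_less[of v u] mod_poly_less[of v u]
  by (auto simp: div_poly_less mod_poly_less)

lemma degree_euclid_pair:
  assumes "0 \<notin> set cs" "h \<noteq> 0"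
  shows "fst (euclid_pair cs h) \<noteq> 0 \<and> degree (fst (euclid_pair cs h)) = degree h + length cs \<and>
    (snd (euclid_pair cs h) = 0 \<or> degree (snd (euclid_pair cs h)) < degree (fst (euclid_pair cs h)))"
  using assms(1)
proof (induction cs)
  case Nil
  then show ?case using assms(2) by simp
next
  case (Cons c cs)
  obtain u v where uv: "euclid_pair cs h = (u, v)" by fastforce
  have c: "c \<noteq> 0" and u: "u \<noteq> 0" "degree u = degree h + length cs" "v = 0 \<or> degree v < degree u"
    using Cons uv by auto
  have deg: "degree ([:0, c:] * u) = Suc (degree u)"
    using c u(1) by (subst degree_mult_eq) auto
  have "degree ([:0, c:] * u + v) = Suc (degree u)"
  proof (cases "v = 0")
    case True
    then show ?thesis using deg by simp
  next
    case False
    then show ?thesis using deg u(3) by (subst degree_add_eq_left) auto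
  qed
  then show ?case using u by (auto simp: euclid_step_def uv)
qed

lemma regular_euclid_pair:
  assumes "0 \<notin> set cs" "h \<noteq> 0"
  shows "regular_euclid (fst (euclid_pair cs h)) (snd (euclid_pair cs h))"
  using assms(1)
proof (induction cs)
  case Nil
  then show ?case by (simp add: regular_euclid_def euclid_quotients.simps)
next
  case (Cons c cs)
  obtain u v where uv: "euclid_pair cs h = (u, v)" by fastforce
  have u: "u \<noteq> 0" "v = 0 \<or> degree v < degree u"
    using degree_euclid_pair[of cs h] Cons.prems assms(2) uv by auto
  have "euclid_quotients ([:0, c:] * u + v) u = [:0, c:] # euclid_quotients u v"
    by (subst euclid_quotients.simps) (simp only: div_mod_step[OF u] u(1) if_False)
  then show ?case using Cons by (simp add: regular_euclid_def euclid_step_def uv)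
qed

text \<open>The pair of an even and an odd polynomial keeps this form along the algorithm, which makes
  the linear quotients odd.\<close>

lemma regular_euclid_imp_pair:
  assumes "regular_euclid u v" "u \<noteq> 0" "v = 0 \<or> degree v < degree u" "\<epsilon> * \<epsilon> = 1"
    and "u \<circ>\<^sub>p [:0, -1:] = Polynomial.smult \<epsilon> u" "v \<circ>\<^sub>p [:0, -1:] = Polynomial.smult (- \<epsilon>) v"
  shows "\<exists>cs h. 0 \<notin> set cs \<and> h \<noteq> 0 \<and> euclid_pair cs h = (u, v)"
  using assms
proof (induction u v arbitrary: \<epsilon> rule: euclid_quotients.induct)
  case (1 u v)
  show ?case
  proof (cases "v = 0")
    case True
    then show ?thesis using 1 by (intro exI[of _ "[]"] exI[of _ u]) simp
  next
    case False
    define q where "q = u div v"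
    define w where "w = u mod v"
    define N where "N = [:0, -1 :: complex:]"
    have quot: "euclid_quotients u v = q # euclid_quotients v w"
      using False by (subst euclid_quotients.simps) (simp add: q_def w_def)
    have w: "w = 0 \<or> degree w < degree v"
      using False degree_mod_less[of v u] by (auto simp: w_def)
    have u: "u = q * v + w" by (simp add: q_def w_def)
    have degN: "degree (f \<circ>\<^sub>p N) = degree f" for f :: "complex poly"
      by (simp add: N_def degree_pcompose)
    \<comment> \<open>Replacing \<open>z\<close> by \<open>-z\<close> and using the parities of
      \<open>u\<close> and \<open>v\<close> gives a second division of \<open>u\<close> by
      \<open>v\<close>. Uniqueness makes \<open>q\<close> odd and gives \<open>w\<close> the parity
      of \<open>u\<close>.\<close>
    have "Polynomial.smult \<epsilon> (Polynomial.smult \<epsilon> u) =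
        Polynomial.smult \<epsilon> ((q \<circ>\<^sub>p N) * (v \<circ>\<^sub>p N) + w \<circ>\<^sub>p N)"
      using "1.prems"(5) u by (metis N_def pcompose_add pcompose_mult)
    then have u': "u = - (q \<circ>\<^sub>p N) * v + Polynomial.smult \<epsilon> (w \<circ>\<^sub>p N)"
      using "1.prems"(4,6) by (simp add: smult_add_right smult_diff_right N_def mult.commute)
    have w': "Polynomial.smult \<epsilon> (w \<circ>\<^sub>p N) = 0 \<or>
        degree (Polynomial.smult \<epsilon> (w \<circ>\<^sub>p N)) < degree v"
      using w degN[of w] by auto
    have "u div v = - (q \<circ>\<^sub>p N)"
      by (subst u') (rule div_mod_step(1)[OF False w'])
    then have q: "q = - (q \<circ>\<^sub>p N)" by (simp only: q_def)
    have "u mod v = Polynomial.smult \<epsilon> (w \<circ>\<^sub>p N)"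
      by (subst u') (rule div_mod_step(2)[OF False w'])
    then have "w = Polynomial.smult \<epsilon> (w \<circ>\<^sub>p N)" by (simp only: w_def)
    then have wN: "w \<circ>\<^sub>p N = Polynomial.smult (- (- \<epsilon>)) w"
      using "1.prems"(4) by (metis add.inverse_inverse smult_1_left smult_smult)
    have "degree q = 1"
      using "1.prems"(1) quot by (simp add: regular_euclid_def)
    then obtain a b where ab: "q = [:a, b:]" "b \<noteq> 0"
      by (rule degree1_coeffs)
    then have "a = 0" using q by (simp add: N_def pcompose_pCons)
    have "regular_euclid v w"
      using "1.prems"(1) quot by (simp add: regular_euclid_def)
    then have "\<exists>cs h. 0 \<notin> set cs \<and> h \<noteq> 0 \<and> euclid_pair cs h = (v, w)"
      using "1.IH"[OF False, folded w_def, of "- \<epsilon>"] False w wN "1.prems"(4,6) by (simp add: N_def)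
    then obtain cs h where "0 \<notin> set cs" "h \<noteq> 0" "euclid_pair cs h = (v, w)" by blast
    then show ?thesis using ab u \<open>a = 0\<close>
      by (intro exI[of _ "b # cs"] exI[of _ h]) (auto simp: euclid_step_def)
  qed
qed

text \<open>A step preserves the common divisors, so \<open>h\<close> is a greatest common divisor
  of the outer pair.\<close>

lemma dvd_euclid_pair_iff:
  "d dvd fst (euclid_pair cs h) \<and> d dvd snd (euclid_pair cs h) \<longleftrightarrow> d dvd h"
proof (induction cs)
  case (Cons c cs)
  obtain u v where uv: "euclid_pair cs h = (u, v)" by fastforce
  have "d dvd [:0, c:] * u + v \<and> d dvd u \<longleftrightarrow> d dvd u \<and> d dvd v"
    using dvd_add_right_iff[of d "[:0, c:] * u" v] dvd_mult[of d u "[:0, c:]"] by blast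
  then show ?case using Cons by (simp add: euclid_step_def uv)
qed simp

text \<open>A common factor multiplies all remainders and leaves the quotients alone, so regularity
  can be tested on the reduced fraction.\<close>

lemma euclid_quotients_mult:
  assumes "d \<noteq> 0"
  shows "euclid_quotients (d * f) (d * g) = euclid_quotients f g"
proof (induction f g rule: euclid_quotients.induct)
  case (1 f g)
  show ?case
  proof (cases "g = 0")
    case True
    then show ?thesis by (simp add: euclid_quotients.simps)
  next
    case False
    have "euclid_quotients f g = f div g # euclid_quotients g (f mod g)"
      using False by (subst euclid_quotients.simps) simp
    moreover have "euclid_quotients (d * f) (d * g) =
        (d * f) div (d * g) # euclid_quotients (d * g) ((d * f) mod (d * g))"
      using False assms by (subst euclid_quotients.simps) simp
    ultimately show ?thesis using 1 False assms by (simp add: mult_mod_right[symmetric])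
  qed
qed

text \<open>Substituting \<open>t = 1 / w\<^sup>2\<close> turns the steps of the S-fraction into the steps of the
  Euclidean algorithm.\<close>

definition pair_rel ::
    "nat \<Rightarrow> complex poly \<times> complex poly \<Rightarrow> complex poly \<times> complex poly \<Rightarrow> bool" where
  "pair_rel d = (\<lambda>(x, y) (u, v). \<forall>w. w \<noteq> 0 \<longrightarrow>
     poly u w = w ^ d * poly x (1 / w\<^sup>2) \<and> poly v w = w ^ Suc d * poly y (1 / w\<^sup>2))"

lemma pair_rel_step:
  assumes "pair_rel d a b"
  shows "pair_rel (Suc d) (sfrac_step c a) (euclid_step c b)"
proof -
  obtain x y u v where ab: "a = (x, y)" "b = (u, v)" by fastforce
  show ?thesis
    unfolding pair_rel_def ab sfrac_step_Pair euclid_step_def prod.case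
  proof (intro allI impI conjI)
    fix w :: complex assume w: "w \<noteq> 0"
    have u: "poly u w = w ^ d * poly x (1 / w\<^sup>2)" and v: "poly v w = w ^ Suc d * poly y (1 / w\<^sup>2)"
      using assms w by (simp_all add: pair_rel_def ab)
    show "poly ([:0, c:] * u + v) w = w ^ Suc d * poly (Polynomial.smult c x + y) (1 / w\<^sup>2)"
      by (simp add: u v algebra_simps)
    show "poly u w = w ^ Suc (Suc d) * poly (pCons 0 x) (1 / w\<^sup>2)"
      using w by (simp add: u power2_eq_square)
  qed
qed

lemma pair_rel_pair: "pair_rel (e + length cs) (sfrac_pair cs [:\<kappa>:]) (euclid_pair cs (monom \<kappa> e))"
proof (induction cs)
  case Nil
  then show ?case by (simp add: pair_rel_def poly_monom)
next
  case (Cons c cs)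
  then show ?case using pair_rel_step by simp
qed

lemma pair_rel_unique_right:
  assumes "pair_rel d a b" "pair_rel d a b'"
  shows "b = b'"
  using assms by (auto simp: pair_rel_def case_prod_beta prod_eq_iff intro!: poly_eq_off_0)

lemma pair_rel_unique_left:
  assumes "pair_rel d a b" "pair_rel d a' b"
  shows "a = a'"
proof -
  have "poly (fst a) t = poly (fst a') t \<and> poly (snd a) t = poly (snd a') t" if "t \<noteq> 0" for t
  proof -
    \<comment> \<open>Every nonzero \<open>t\<close> has the form \<open>1 / w^2\<close>, so the
      values of \<open>u\<close> and \<open>v\<close> determine those of the S-fraction
      pair.\<close>
    define w where "w = 1 / csqrt t"
    have w: "w \<noteq> 0" "1 / w\<^sup>2 = t" using that by (auto simp: w_def power_divide)
    show ?thesis using assms w by (auto simp: pair_rel_def case_prod_beta)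
  qed
  then show ?thesis by (auto simp: prod_eq_iff intro!: poly_eq_off_0)
qed

lemma complex_poly_only_root_0:
  fixes h :: "complex poly"
  assumes "h \<noteq> 0" "\<And>z. poly h z = 0 \<Longrightarrow> z = 0"
  obtains \<kappa> where "\<kappa> \<noteq> 0" "h = monom \<kappa> (degree h)"
proof -
  obtain f where f: "h = [:0, 1:] ^ Polynomial.order 0 h * f" "\<not> [:0, 1:] dvd f"
    using order_decomp[OF assms(1), of 0] by auto
  have "poly f z \<noteq> 0" for z
  proof
    assume "poly f z = 0"
    then have "poly h z = 0" using f(1) by (metis mult_zero_right poly_mult)
    then have "z = 0" by (rule assms(2))
    then show False using \<open>poly f z = 0\<close> f(2) by (simp add: dvd_iff_poly_eq_0)
  qed
  then have "degree f = 0" using alg_closed_imp_poly_has_root[of f] by auto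
  then obtain \<kappa> where \<kappa>: "f = [:\<kappa>:]" by (rule degree_eq_zeroE)
  have "h = monom \<kappa> (Polynomial.order 0 h)"
    using f(1) \<kappa> by (simp add: monom_altdef)
  moreover have "\<kappa> \<noteq> 0" using calculation assms(1) by auto
  ultimately show thesis using that by (metis degree_monom_eq)
qed

text \<open>The polynomials \<open>f1(w^2)\<close> and \<open>w f2(w^2)\<close> vanish together at
  most at 0, so the innermost polynomial is a monomial. Its degree is 1 if \<open>f1(0) = 0\<close>
  and 0 otherwise, because \<open>w^2\<close> dividing \<open>w f2(w^2)\<close> would give
  \<open>f2(0) = 0\<close>. The number of divisions is \<open>2 r\<close> minus this degree, which
  is \<open>k\<close>.\<close>

lemma regular_euclid_iff_sfrac_pair:
  fixes f1 f2 :: "complex poly"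
  assumes cop: "\<And>z. poly f1 z = 0 \<Longrightarrow> poly f2 z \<noteq> 0"
    and deg: "degree f1 = r" "degree f2 < r"
    and k: "k = (if poly f1 0 = 0 then 2 * r - 1 else 2 * r)"
  shows "regular_euclid (f1 \<circ>\<^sub>p monom 1 2) (monom 1 1 * (f2 \<circ>\<^sub>p monom 1 2)) \<longleftrightarrow>
    (\<exists>cs \<kappa>. length cs = k \<and> 0 \<notin> set cs \<and> \<kappa> \<noteq> 0 \<and>
      sfrac_pair cs [:\<kappa>:] = (rev_poly r f1, rev_poly r f2))"
    (is "regular_euclid ?u ?v \<longleftrightarrow> ?R")
proof -
  have pu: "poly ?u w = poly f1 (w\<^sup>2)" and pv: "poly ?v w = w * poly f2 (w\<^sup>2)" for w
    by (simp_all add: poly_pcompose poly_monom)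
  have degu: "degree ?u = 2 * r" and u0: "?u \<noteq> 0"
    using deg by (auto simp: degree_pcompose degree_monom_eq pcompose_eq_0_iff)
  have degv: "?v = 0 \<or> degree ?v < degree ?u"
  proof -
    have "degree ?v \<le> 1 + degree (f2 \<circ>\<^sub>p monom 1 2)"
      using degree_mult_le[of "monom 1 1 :: complex poly" "f2 \<circ>\<^sub>p monom 1 2"]
      by (simp add: degree_monom_eq)
    then show ?thesis using degu deg by (simp add: degree_pcompose degree_monom_eq)
  qed
  have rel: "pair_rel (2 * r) (rev_poly r f1, rev_poly r f2) (?u, ?v)"
    using deg unfolding pair_rel_def prod.case pu pv
    by (simp add: poly_rev_poly power_divide power_mult)
  show ?thesis
  proof
    assume "?R"
    then obtain cs \<kappa> where cs: "length cs = k" "0 \<notin> set cs" "\<kappa> \<noteq> 0"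
      "sfrac_pair cs [:\<kappa>:] = (rev_poly r f1, rev_poly r f2)" by blast
    \<comment> \<open>The monomial of degree \<open>2 r - k\<close> fills the degree up to
      \<open>2 r\<close>.\<close>
    have "2 * r - k + length cs = 2 * r" using cs(1) k by auto
    then have "euclid_pair cs (monom \<kappa> (2 * r - k)) = (?u, ?v)"
      using pair_rel_pair[of "2 * r - k" cs \<kappa>] rel pair_rel_unique_right unfolding cs(4) by metis
    then show "regular_euclid ?u ?v"
      using regular_euclid_pair[OF cs(2), of "monom \<kappa> (2 * r - k)"] cs(3) by simp
  next
    assume reg: "regular_euclid ?u ?v"
    have "\<exists>cs h. 0 \<notin> set cs \<and> h \<noteq> 0 \<and> euclid_pair cs h = (?u, ?v)"
    proof (rule regular_euclid_imp_pair[OF reg u0 degv, of 1])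
      show "?u \<circ>\<^sub>p [:0, -1:] = Polynomial.smult 1 ?u" "?v \<circ>\<^sub>p [:0, -1:] = Polynomial.smult (-1) ?v"
        by (rule poly_ext, simp add: poly_pcompose poly_monom)+
    qed simp
    then obtain cs h where cs: "0 \<notin> set cs" "h \<noteq> 0" "euclid_pair cs h = (?u, ?v)" by blast
    have dvd: "d dvd h \<longleftrightarrow> d dvd ?u \<and> d dvd ?v" for d
      using dvd_euclid_pair_iff[of d cs h] cs(3) by auto
    have root: "poly h z = 0 \<longleftrightarrow> poly ?u z = 0 \<and> poly ?v z = 0" for z
      using dvd[of "[:-z, 1:]"] by (simp only: poly_eq_0_iff_dvd)
    have only0: "z = 0" if "poly h z = 0" for z
      using that cop[of "z\<^sup>2"] unfolding root pu pv by auto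
    obtain \<kappa> where \<kappa>: "\<kappa> \<noteq> 0" "h = monom \<kappa> (degree h)"
      using complex_poly_only_root_0[OF cs(2) only0] by blast
    have "degree h + length cs = 2 * r"
      using degree_euclid_pair[OF cs(1,2)] cs(3) degu by simp
    moreover have "degree h = (if poly f1 0 = 0 then 1 else 0)"
    proof (cases "poly f1 0 = 0")
      case True
      have "poly h 0 = 0" unfolding root pu pv using True by simp
      moreover have "poly h 0 = \<kappa> * 0 ^ degree h"
        by (subst \<kappa>(2)) (simp add: poly_monom)
      ultimately have "degree h \<noteq> 0" using \<kappa>(1) by auto
      moreover have "degree h < 2"
      proof (rule ccontr)
        assume "\<not> degree h < 2"
        then have e: "2 + (degree h - 2) = degree h" by linarith
        have "monom 1 2 dvd h"
          by (intro dvdI[of _ _ "monom \<kappa> (degree h - 2)"], subst \<kappa>(2))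
            (simp only: mult_monom e mult_1_left)
        then have "monom 1 2 dvd ?v" unfolding dvd by (rule conjunct2)
        moreover have "monom 1 2 = monom 1 1 * [:0, 1 :: complex:]"
          by (simp add: monom_altdef power2_eq_square)
        ultimately have "monom 1 1 * [:0, 1:] dvd monom 1 1 * (f2 \<circ>\<^sub>p monom 1 2)"
          by (simp only:)
        then have "[:0, 1:] dvd f2 \<circ>\<^sub>p monom 1 2"
          unfolding dvd_mult_cancel_left by simp
        then have "poly f2 0 = 0"
          using poly_eq_0_iff_dvd[of "f2 \<circ>\<^sub>p monom 1 2" 0] by (simp add: poly_pcompose poly_monom)
        then show False using cop True by blast
      qed
      ultimately show ?thesis using True by simp
    next
      case False
      then have "poly h 0 \<noteq> 0" unfolding root pu by simp
      moreover have "poly h 0 = \<kappa> * 0 ^ degree h"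
        by (subst \<kappa>(2)) (simp add: poly_monom)
      ultimately show ?thesis using False by (cases "degree h") auto
    qed
    ultimately have "length cs = k" using k by (auto split: if_splits)
    moreover have "sfrac_pair cs [:\<kappa>:] = (rev_poly r f1, rev_poly r f2)"
      using pair_rel_pair[of "degree h" cs \<kappa>] rel pair_rel_unique_left
      unfolding \<kappa>(2)[symmetric] cs(3) \<open>degree h + length cs = 2 * r\<close> by blast
    ultimately show ?R using cs(1) \<kappa>(1) by blast
  qed
qed

section \<open>Expansion at infinity and poles\<close>

text \<open>With \<open>w = 1 / z\<close> the expansion becomes a power series at 0. Clearing
  denominators gives an identity of functions near 0, hence one of formal power series.\<close>

lemma laurent_at_infinity_ratfun:
  assumes s: "laurent_at_infinity (ratfun q p) s"
    and p: "p \<noteq> 0" "degree p = n" "degree q \<le> n"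
  shows "Abs_fps (\<lambda>m. s (int m - 1)) * fps_of_poly (rev_poly n p) = fps_of_poly (rev_poly n q)"
proof -
  define S where "S = Abs_fps (\<lambda>m. s (int m - 1))"
  obtain b where b: "\<And>z. b \<le> norm z \<Longrightarrow> (\<lambda>m. s (int m - 1) / z ^ m) sums ratfun q p z"
    using s unfolding laurent_at_infinity_def eventually_at_infinity by blast
  \<comment> \<open>The bound \<open>b\<close> may be zero or negative; the maximum makes
    \<open>d\<close> a positive radius.\<close>
  define d where "d = 1 / max b 1"
  have d: "d > 0" by (simp add: d_def)
  have sums: "(\<lambda>m. fps_nth S m * w ^ m) sums ratfun q p (1 / w)" if "w \<noteq> 0" "norm w \<le> d" for w
  proof -
    have "b * norm w \<le> 1"
      using that d mult_mono[of b "max b 1" "norm w" d] by (auto simp: d_def split: if_splits)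
    then have "b \<le> norm (1 / w)"
      using that by (simp add: norm_divide field_simps)
    from b[OF this] show ?thesis using that by (simp add: S_def power_divide)
  qed
  have "fps_conv_radius S \<ge> norm (complex_of_real d)"
    unfolding fps_conv_radius_def
    by (rule conv_radius_geI) (use sums[of "complex_of_real d"] d in \<open>auto simp: sums_iff\<close>)
  then have "fps_conv_radius S > 0"
    using d by (metis ereal_less(2) less_le_trans norm_of_real abs_of_pos)
  then have exp: "eval_fps S has_fps_expansion S"
    by (rule eval_fps_has_fps_expansion)
  have exp_poly: "poly f has_fps_expansion fps_of_poly f" for f :: "complex poly"
  proof -
    have "eval_fps (fps_of_poly f) = poly f" by (rule ext) simp
    then show ?thesis using eval_fps_has_fps_expansion[of "fps_of_poly f"] by simp
  qed
  define h where "h = (\<lambda>w. eval_fps S w * poly (rev_poly n p) w - poly (rev_poly n q) w)"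
  have h: "h has_fps_expansion S * fps_of_poly (rev_poly n p) - fps_of_poly (rev_poly n q)"
    unfolding h_def by (intro has_fps_expansion_diff has_fps_expansion_mult exp exp_poly)
  have "eventually (\<lambda>w. h w = 0) (at 0)"
  proof -
    have "eventually (\<lambda>w. poly (rev_poly n p) w \<noteq> 0) (at 0)"
    proof -
      have "isCont (poly (rev_poly n p)) 0" by simp
      moreover have "poly (rev_poly n p) 0 \<noteq> 0" using p by (auto simp: poly_rev_poly_0)
      ultimately show ?thesis
        by (intro tendsto_imp_eventually_ne) (auto simp: isCont_def)
    qed
    moreover have "eventually (\<lambda>w. w \<noteq> 0 \<and> norm w \<le> d) (at (0::complex))"
      using d by (auto simp: eventually_at intro!: exI[of _ d])
    ultimately show ?thesis
    proof eventually_elim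
      case (elim w)
      then have "eval_fps S w = poly q (1 / w) / poly p (1 / w)"
        using sums[of w] by (simp add: eval_fps_def sums_iff ratfun_def)
      then show ?case using elim p by (auto simp: h_def poly_rev_poly)
    qed
  qed
  \<comment> \<open>So far \<open>h\<close> vanishes only on a punctured neighbourhood; continuity
    supplies the centre.\<close>
  moreover have "h 0 = 0"
  proof -
    have "(h \<longlongrightarrow> h 0) (at 0)"
      using has_fps_expansion_imp_continuous[OF h, of UNIV] by (simp add: continuous_within)
    moreover have "(h \<longlongrightarrow> 0) (at 0)"
      using \<open>eventually (\<lambda>w. h w = 0) (at 0)\<close> by (rule tendsto_eventually)
    ultimately show ?thesis using tendsto_unique trivial_limit_at by blast
  qed
  ultimately have "eventually (\<lambda>w. h w = 0) (nhds 0)"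
    by (simp add: eventually_nhds_conv_at)
  then have "h has_fps_expansion 0" by (simp add: has_fps_expansion_0_iff)
  with h have "S * fps_of_poly (rev_poly n p) - fps_of_poly (rev_poly n q) = 0"
    by (rule fps_expansion_unique_complex)
  then show ?thesis by (simp add: S_def)
qed

section \<open>Poles of rational functions and their multiplicities\<close>

lemma eventually_poly_nonzero_at:
  fixes f :: "complex poly"
  assumes "f \<noteq> 0"
  shows "eventually (\<lambda>w. poly f w \<noteq> 0) (at z)"
proof -
  have "finite ({w. poly f w = 0} - {z})" using assms by (simp add: poly_roots_finite)
  then have "open (- ({w. poly f w = 0} - {z}))" by (intro open_Compl finite_imp_closed)
  then show ?thesis
    unfolding eventually_at_topological by (intro exI[of _ "- ({w. poly f w = 0} - {z})"]) auto
qed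

lemma ratfun_reduced:
  assumes "g \<noteq> 0"
  shows "eventually (\<lambda>w. ratfun (g * q) (g * p) w = ratfun q p w) (at z)"
  using eventually_poly_nonzero_at[OF assms] by eventually_elim (simp add: ratfun_def)

lemma is_pole_ratfun_iff:
  assumes "p \<noteq> 0" "poly p z = 0 \<Longrightarrow> poly q z \<noteq> 0"
  shows "is_pole (ratfun q p) z \<longleftrightarrow> poly p z = 0"
proof
  assume "is_pole (ratfun q p) z"
  then show "poly p z = 0"
  proof (rule contrapos_pp)
    have an: "poly f analytic_on {z}" for f :: "complex poly"
    proof -
      have "(\<lambda>w. poly f w) holomorphic_on UNIV" by (intro holomorphic_intros)
      then show ?thesis using holomorphic_on_imp_analytic_at[of "poly f" UNIV z] by simp
    qed
    assume "poly p z \<noteq> 0"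
    then show "\<not> is_pole (ratfun q p) z"
      unfolding ratfun_def by (intro analytic_at_imp_no_pole analytic_on_divide an) auto
  qed
next
  assume z: "poly p z = 0"
  have "filterlim (poly p) (at 0) (at z)"
    using isContD[OF poly_isCont[of z p]] eventually_poly_nonzero_at[OF assms(1), of z]
    by (simp add: filterlim_at z)
  then show "is_pole (ratfun q p) z"
    unfolding ratfun_def using assms(2)[OF z] by (intro is_pole_divide) auto
qed

lemma zorder_ratfun:
  assumes "p \<noteq> 0" "poly p z = 0" "poly q z \<noteq> 0"
  shows "zorder (ratfun q p) z = - int (Polynomial.order z p)"
proof -
  obtain h where h: "p = [:-z, 1:] ^ Polynomial.order z p * h" "\<not> [:-z, 1:] dvd h"
    using order_decomp[OF assms(1), of z] by auto
  have hz: "poly h z \<noteq> 0" using h(2) by (simp add: poly_eq_0_iff_dvd)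
  have "open {w. poly h w \<noteq> 0}"
    by (intro open_Collect_neq continuous_intros)
  then show ?thesis
  proof (rule zorder_eqI[where g = "\<lambda>w. poly q w / poly h w"])
    fix w assume "w \<in> {w. poly h w \<noteq> 0}" "w \<noteq> z"
    have "poly p w = (w - z) ^ Polynomial.order z p * poly h w"
      by (subst h(1)) (simp add: poly_power)
    then show "ratfun q p w = poly q w / poly h w * (w - z) powi (- int (Polynomial.order z p))"
      by (simp add: ratfun_def power_int_minus field_simps)
  qed (use hz assms(3) in \<open>auto intro!: holomorphic_intros\<close>)
qed

lemma pole_count_ratfun:
  assumes "p \<noteq> 0" "\<And>z. poly p z = 0 \<Longrightarrow> poly q z \<noteq> 0"
  shows "pole_count (ratfun q p) = degree p"
proof -
  have "pole_count (ratfun q p) = (\<Sum>z | poly p z = 0. Polynomial.order z p)"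
    unfolding pole_count_def using assms
    by (intro sum.cong) (auto simp: is_pole_ratfun_iff zorder_ratfun)
  also have "\<dots> = size (proots p)"
    using assms(1) by (simp add: size_multiset_overloaded_eq)
  finally show ?thesis by (simp add: size_proots_complex)
qed

lemma pole_count_cong:
  assumes "\<And>z. eventually (\<lambda>w. f w = g w) (at z)"
  shows "pole_count f = pole_count g"
proof -
  have "is_pole f = is_pole g" using is_pole_cong[OF assms refl] by (rule ext)
  then show ?thesis unfolding pole_count_def using zorder_cong[OF assms refl] by simp
qed

section \<open>Stieltjes fractions\<close>

lemma MOST_poly_nonzero:
  fixes f :: "complex poly"
  assumes "f \<noteq> 0"
  shows "MOST z. poly f z \<noteq> 0"
  using poly_roots_finite[OF assms] by (simp add: eventually_cofinite)

lemma MOST_poly_inverse_nonzero: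
  fixes f :: "complex poly"
  assumes "f \<noteq> 0"
  shows "MOST z. poly f (1 / z) \<noteq> 0"
  using MOST_poly_nonzero[OF assms] by (rule MOST_inj) (auto intro: injI)

lemma MOST_poly_inverse_eq_iff:
  fixes f h :: "complex poly"
  shows "(MOST z. poly f (1 / z) = poly h (1 / z)) \<longleftrightarrow> f = h"
proof
  assume eq: "MOST z. poly f (1 / z) = poly h (1 / z)"
  show "f = h"
  proof (rule ccontr)
    assume "f \<noteq> h"
    then have "MOST z. poly (f - h) (1 / z) \<noteq> 0" by (intro MOST_poly_inverse_nonzero) simp
    with eq have "MOST z :: complex. False" by eventually_elim simp
    then show False by (simp add: infinite_UNIV_char_0)
  qed
qed simp

text \<open>With \<open>x\<close>, \<open>y\<close> the components evaluated at
  \<open>1 / z\<close>, a tail equals \<open>x / (z y)\<close>, times \<open>z\<close> if its first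
  index is odd. The nonvanishing claims are carried along so that division by zero occurs at
  finitely many points only.\<close>

lemma stieltjes_frac_sfrac_pair:
  assumes "\<And>i. j \<le> i \<Longrightarrow> i \<le> j + m \<Longrightarrow> c i \<noteq> 0"
  defines "w \<equiv> sfrac_pair (map c [j..<Suc (j + m)]) 1"
  shows "fst w \<noteq> 0 \<and> (MOST z. z \<noteq> 0 \<and> poly (fst w) (1 / z) \<noteq> 0 \<and> poly (snd w) (1 / z) \<noteq> 0 \<and>
    stieltjes_frac c z j m =
      (if odd j then z else 1) * poly (fst w) (1 / z) / (z * poly (snd w) (1 / z)))"
  unfolding w_def using assms(1)
proof (induction m arbitrary: j)
  case 0
  have "MOST z::complex. z \<noteq> 0" by (simp add: eventually_cofinite)
  then have "MOST z. z \<noteq> 0 \<and> stieltjes_frac c z j 0 = (if odd j then z else 1) * c j"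
    by eventually_elim simp
  moreover have w: "sfrac_pair (map c [j..<Suc (j + 0)]) 1 = ([:c j:], [:0, 1:])"
    by (simp add: one_pCons)
  ultimately show ?case
    unfolding w using 0[of j] by (auto elim!: eventually_mono simp del: stieltjes_frac.simps)
next
  case (Suc m)
  define v where "v = sfrac_pair (map c [Suc j..<Suc (Suc j + m)]) 1"
  have IH: "fst v \<noteq> 0" "MOST z. z \<noteq> 0 \<and> poly (fst v) (1 / z) \<noteq> 0 \<and> poly (snd v) (1 / z) \<noteq> 0 \<and>
      stieltjes_frac c z (Suc j) m =
        (if odd (Suc j) then z else 1) * poly (fst v) (1 / z) / (z * poly (snd v) (1 / z))"
    using Suc.IH[of "Suc j"] Suc.prems by (auto simp: v_def)
  have w: "sfrac_pair (map c [j..<Suc (j + Suc m)]) 1 = sfrac_step (c j) v"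
    by (subst upt_conv_Cons) (simp_all add: v_def del: upt_Suc)
  have "0 \<notin> set (map c [j..<Suc (j + Suc m)])" using Suc.prems by auto
  then have "poly (fst (sfrac_step (c j) v)) 0 \<noteq> 0"
    unfolding w[symmetric] poly_sfrac_pair_0 by (simp add: prod_list_zero_iff del: upt_Suc)
  then have f: "fst (sfrac_step (c j) v) \<noteq> 0" by auto
  have "MOST z. z \<noteq> 0 \<and> poly (fst (sfrac_step (c j) v)) (1 / z) \<noteq> 0 \<and>
      poly (snd (sfrac_step (c j) v)) (1 / z) \<noteq> 0 \<and> stieltjes_frac c z j (Suc m) =
      (if odd j then z else 1) * poly (fst (sfrac_step (c j) v)) (1 / z) /
        (z * poly (snd (sfrac_step (c j) v)) (1 / z))"
    using IH(2) MOST_poly_inverse_nonzero[OF f]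
  proof eventually_elim
    case (elim z)
    define a where "a = poly (fst v) (1 / z)"
    define b where "b = poly (snd v) (1 / z)"
    have ab: "a \<noteq> 0" "b \<noteq> 0" "z \<noteq> 0" and
      frac: "stieltjes_frac c z (Suc j) m = (if even j then z else 1) * a / (z * b)"
      using elim by (simp_all add: a_def b_def)
    have step: "poly (fst (sfrac_step (c j) v)) (1 / z) = c j * a + b"
      "poly (snd (sfrac_step (c j) v)) (1 / z) = a / z"
      by (simp_all add: sfrac_step_def case_prod_beta a_def b_def)
    \<comment> \<open>Inverting the tail switches the parity factor to that of the term
      \<open>c j\<close>, so both summands share it.\<close>
    have "1 / stieltjes_frac c z (Suc j) m = (if odd j then z else 1) * (b / a)"
      unfolding frac using ab by (cases "odd j") simp_all
    then have "stieltjes_frac c z j (Suc m) = (if odd j then z else 1) * (c j + b / a)"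
      by (cases "odd j") (simp_all add: distrib_left mult.commute)
    moreover have "c j + b / a = (c j * a + b) / a" using ab by (simp add: add_divide_distrib)
    moreover have "z * (a / z) = a" using ab by simp
    ultimately have "stieltjes_frac c z j (Suc m) =
        (if odd j then z else 1) * (c j * a + b) / (z * (a / z))"
      by (simp only: times_divide_eq_right)
    moreover have "c j * a + b \<noteq> 0" "a / z \<noteq> 0" using elim(2) ab unfolding step by auto
    ultimately show ?case using ab(3) unfolding step by blast
  qed
  with f show ?case unfolding w by blast
qed

lemma coprime_if_no_common_root:
  fixes f h :: "complex poly"
  assumes "f \<noteq> 0" "\<And>z. poly f z = 0 \<Longrightarrow> poly h z \<noteq> 0"
  shows "coprime f h"
proof (rule coprimeI)
  fix d assume d: "d dvd f" "d dvd h"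
  have "d \<noteq> 0" using d assms(1) by auto
  moreover have "degree d = 0"
  proof (rule ccontr)
    assume "degree d \<noteq> 0"
    then obtain z where "poly d z = 0" using alg_closed_imp_poly_has_root[of d] by auto
    then show False using d assms(2)[of z] by (auto elim!: dvdE)
  qed
  ultimately show "is_unit d" by (simp add: is_unit_iff_degree)
qed

lemma dvd_antisym_poly:
  fixes f h :: "complex poly"
  assumes "f dvd h" "h dvd f" "f \<noteq> 0"
  obtains \<kappa> where "\<kappa> \<noteq> 0" "h = Polynomial.smult \<kappa> f"
proof -
  obtain a where a: "h = f * a" using assms(1) by (elim dvdE)
  have "f * a dvd f * 1" using assms(2) a by simp
  then have "is_unit a" using assms(3) by (simp only: dvd_mult_cancel_left) simp
  then obtain \<kappa> where "a = [:\<kappa>:]" "is_unit \<kappa>" unfolding is_unit_poly_iff by blast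
  moreover then have "\<kappa> \<noteq> 0" by auto
  ultimately show thesis using a by (intro that[of \<kappa>]) auto
qed

text \<open>By coprimality each denominator divides the other, so they differ by a constant, and
  then so do the numerators.\<close>

lemma reduced_fractions_eq_iff:
  fixes a b x y :: "complex poly"
  assumes "a \<noteq> 0" "\<And>z. poly a z = 0 \<Longrightarrow> poly b z \<noteq> 0"
    and "x \<noteq> 0" "\<And>z. poly x z = 0 \<Longrightarrow> poly y z \<noteq> 0"
  shows "y * a = b * x \<longleftrightarrow> (\<exists>\<kappa>. \<kappa> \<noteq> 0 \<and> x = a * [:\<kappa>:] \<and> y = b * [:\<kappa>:])"
proof
  assume eq: "y * a = b * x"
  have "a dvd b * x" "x dvd y * a" by (simp_all add: eq[symmetric]) (simp add: eq)
  moreover have "coprime a b" "coprime x y"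
    using assms by (auto intro: coprime_if_no_common_root)
  ultimately have "a dvd x" "x dvd a"
    using coprime_dvd_mult_right_iff[of a b x] coprime_dvd_mult_right_iff[of x y a] by blast+
  then obtain \<kappa> where \<kappa>: "\<kappa> \<noteq> 0" "x = Polynomial.smult \<kappa> a"
    using dvd_antisym_poly assms(1) by blast
  then have "y * a = (b * [:\<kappa>:]) * a" using eq by simp
  then have "y = b * [:\<kappa>:]" using assms(1) by (metis mult_right_cancel)
  then show "\<exists>\<kappa>. \<kappa> \<noteq> 0 \<and> x = a * [:\<kappa>:] \<and> y = b * [:\<kappa>:]" using \<kappa> by auto
qed (auto simp: mult_ac)

lemma inf_mat_eq_sym: "inf_mat_eq A B \<Longrightarrow> inf_mat_eq B A"
  and inf_mat_eq_trans: "inf_mat_eq A B \<Longrightarrow> inf_mat_eq B C \<Longrightarrow> inf_mat_eq A C"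
  by (auto simp: inf_mat_eq_def)

section \<open>Reduced fractions\<close>

text \<open>Here \<open>f2 / f1\<close> is \<open>R - c0\<close> in lowest terms, so the poles are
  read off \<open>f1\<close>: their number is its degree, and 0 is a pole exactly if it is a
  root.\<close>

locale reduced_fraction =
  fixes p q g f1 f2 :: "complex poly" and c0 :: complex and n r k :: nat and s :: "int \<Rightarrow> complex"
  assumes p: "p = g * f1" and q: "q - Polynomial.smult c0 p = g * f2"
    and g_nz: "g \<noteq> 0" and gcd: "is_a_gcd g p q"
    and cop: "\<And>z. poly f1 z = 0 \<Longrightarrow> poly f2 z \<noteq> 0"
    and deg_p: "degree p = n" and deg_q: "degree q \<le> n"
    and c0: "c0 = coeff q n / coeff p n"
    and f1_nz: "f1 \<noteq> 0" and deg_f1: "degree f1 = r" and r: "r \<ge> 1"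
    and k: "k = (if poly f1 0 = 0 then 2 * r - 1 else 2 * r)"
    and s: "laurent_at_infinity (ratfun q p) s"
begin

definition base where "base = (rev_poly r f1, rev_poly r f2)"

text \<open>The common form to which the conditions are reduced. The constant
  \<open>\<kappa>\<close> is free because a fraction fixes its pair only up to scaling.\<close>

definition sfrac_coeffs :: "complex list \<Rightarrow> bool" where
  "sfrac_coeffs cs \<longleftrightarrow> 0 \<notin> set cs \<and> (\<exists>\<kappa>. \<kappa> \<noteq> 0 \<and> sfrac_pair cs [:\<kappa>:] = base)"

lemma p_nz: "p \<noteq> 0" using p g_nz f1_nz by simp

lemma lead_p: "coeff p n \<noteq> 0" using p_nz deg_p by auto

lemma k_pos: "k \<ge> 1" using k r by (auto split: if_splits)

lemma deg_g: "degree g = n - r" "r \<le> n"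
  using deg_p deg_f1 g_nz f1_nz unfolding p by (auto simp: degree_mult_eq)

lemma coeff_diff_n: "coeff (q - Polynomial.smult c0 p) n = 0"
  using lead_p c0 by simp

lemma deg_diff: "degree (q - Polynomial.smult c0 p) \<le> n"
  using deg_q deg_p by (intro degree_diff_le) (auto intro: order_trans[OF degree_smult_le])

text \<open>The choice of \<open>c0\<close> removes the coefficient of \<open>z^n\<close> from
  \<open>q - c0 p\<close>.\<close>

lemma deg_f2: "degree f2 < r"
proof (cases "f2 = 0")
  case True
  then show ?thesis using r by simp
next
  case False
  have "degree (g * f2) \<noteq> n"
    using coeff_diff_n False g_nz unfolding q by (metis leading_coeff_0_iff mult_eq_0_iff)
  then have "degree (g * f2) < n" using deg_diff unfolding q by simp
  then show ?thesis using deg_g False g_nz by (simp add: degree_mult_eq)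
qed

lemma rev_p: "rev_poly n p = rev_poly (n - r) g * fst base"
  using rev_poly_mult[of g "n - r" f1 r] deg_g deg_f1 by (simp add: p base_def)

lemma rev_diff: "rev_poly n (q - Polynomial.smult c0 p) = rev_poly (n - r) g * snd base"
  using rev_poly_mult[of g "n - r" f2 r] deg_g deg_f2 by (simp add: q base_def)

lemma rev_g_0: "poly (rev_poly (n - r) g) 0 \<noteq> 0"
  using g_nz deg_g by (metis leading_coeff_0_iff poly_rev_poly_0)

lemma rev_g_nz: "rev_poly (n - r) g \<noteq> 0"
  using rev_g_0 by auto

lemma fst_base_0: "poly (fst base) 0 = coeff f1 r" "coeff f1 r \<noteq> 0"
  using f1_nz deg_f1 by (auto simp: base_def poly_rev_poly_0)

lemma snd_base_0: "poly (snd base) 0 = 0"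
  using deg_f2 by (simp add: base_def poly_rev_poly_0 coeff_eq_0)

lemma base_no_common_root: "poly (fst base) z = 0 \<Longrightarrow> poly (snd base) z \<noteq> 0"
  using fst_base_0 cop[of "1 / z"] deg_f1 deg_f2
  by (cases "z = 0") (auto simp: base_def poly_rev_poly)

section \<open>Stieltjes expansion and matrix factorization of the reduced fraction\<close>

lemma ratfun_eq_reduced:
  "MOST z. ratfun q p z = c0 + poly (snd base) (1 / z) / poly (fst base) (1 / z)"
proof -
  have "MOST z. z \<noteq> (0::complex)" by (simp add: eventually_cofinite)
  with MOST_poly_nonzero[OF p_nz] show ?thesis
  proof eventually_elim
    case (elim z)
    have "poly (q - Polynomial.smult c0 p) z = poly (g * f2) z" by (simp only: q)
    then have "poly q z = c0 * poly p z + poly g z * poly f2 z"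
      by (simp add: algebra_simps)
    then have "ratfun q p z = c0 + poly f2 z / poly f1 z"
      using elim(1) by (simp add: ratfun_def p add_divide_distrib)
    then show ?case using elim(2) deg_f1 deg_f2 by (simp add: base_def poly_rev_poly)
  qed
qed

text \<open>Both sides are \<open>c0\<close> plus a fraction in \<open>1 / z\<close> in lowest
  terms. Equality at almost all points therefore makes the pairs agree up to a constant, which
  becomes \<open>\<kappa>\<close>.\<close>

lemma stieltjes_expansion_iff:
  "stieltjes_expansion p q k c \<longleftrightarrow> c 0 = c0 \<and> sfrac_coeffs (map c [1..<Suc k])"
proof -
  have nz: "(\<forall>j\<in>{1..k}. c j \<noteq> 0) \<longleftrightarrow> 0 \<notin> set (map c [1..<Suc k])"
    by (auto simp: Bex_def image_iff)
  have main: "(MOST z. ratfun q p z = stieltjes_frac c z 0 k) \<longleftrightarrow>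
      (\<exists>\<kappa>. \<kappa> \<noteq> 0 \<and> sfrac_pair (map c [1..<Suc k]) [:\<kappa>:] = base)"
    if "0 \<notin> set (map c [1..<Suc k])" "c 0 = c0"
  proof -
    define w where "w = sfrac_pair (map c [1..<Suc k]) 1"
    obtain l where l: "k = Suc l" using k_pos by (cases k) auto
    have w: "fst w \<noteq> 0" "MOST z. z \<noteq> 0 \<and> poly (fst w) (1 / z) \<noteq> 0 \<and> poly (snd w) (1 / z) \<noteq> 0 \<and>
        stieltjes_frac c z 1 l = z * poly (fst w) (1 / z) / (z * poly (snd w) (1 / z))"
      using stieltjes_frac_sfrac_pair[of 1 l c] that(1) unfolding nz[symmetric]
      by (auto simp: l w_def)
    have b: "fst base \<noteq> 0" using fst_base_0 by auto
    have frac: "MOST z. stieltjes_frac c z 0 k = c0 + poly (snd w) (1 / z) / poly (fst w) (1 / z)"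
      using w(2) by eventually_elim (simp add: l that(2))
    have "(MOST z. ratfun q p z = stieltjes_frac c z 0 k) \<longleftrightarrow>
        (MOST z. poly (snd base * fst w) (1 / z) = poly (snd w * fst base) (1 / z))"
    proof (rule eventually_cong[OF eventually_conj[OF eventually_conj[OF ratfun_eq_reduced frac]
            eventually_conj[OF MOST_poly_inverse_nonzero[OF b] MOST_poly_inverse_nonzero[OF w(1)]]]])
      fix z assume "(ratfun q p z = c0 + poly (snd base) (1 / z) / poly (fst base) (1 / z) \<and>
          stieltjes_frac c z 0 k = c0 + poly (snd w) (1 / z) / poly (fst w) (1 / z)) \<and>
        poly (fst base) (1 / z) \<noteq> 0 \<and> poly (fst w) (1 / z) \<noteq> 0"
      then show "(ratfun q p z = stieltjes_frac c z 0 k) \<longleftrightarrow>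
          (poly (snd base * fst w) (1 / z) = poly (snd w * fst base) (1 / z))"
        by (simp add: frac_eq_eq)
    qed
    also have "\<dots> \<longleftrightarrow> snd base * fst w = snd w * fst base"
      by (rule MOST_poly_inverse_eq_iff)
    also have "\<dots> \<longleftrightarrow> (\<exists>\<kappa>. \<kappa> \<noteq> 0 \<and> fst base = fst w * [:\<kappa>:] \<and> snd base = snd w * [:\<kappa>:])"
      using sfrac_pair_no_common_root[OF that(1)] base_no_common_root w(1) b
      by (intro reduced_fractions_eq_iff) (auto simp: w_def)
    also have "\<dots> \<longleftrightarrow> (\<exists>\<kappa>. \<kappa> \<noteq> 0 \<and> sfrac_pair (map c [1..<Suc k]) [:\<kappa>:] = base)"
    proof -
      have "sfrac_pair (map c [1..<Suc k]) [:\<kappa>:] = (fst w * [:\<kappa>:], snd w * [:\<kappa>:])" for \<kappa>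
        using sfrac_pair_mult[of "map c [1..<Suc k]" 1 "[:\<kappa>:]"] by (simp only: w_def mult_1_left)
      then show ?thesis by (auto simp only: prod_eq_iff fst_conv snd_conv)
    qed
    finally show ?thesis .
  qed
  show ?thesis
    unfolding stieltjes_expansion_def sfrac_coeffs_def deg_p c0[symmetric] nz using main by blast
qed

lemma is_a_gcd_iff: "is_a_gcd h p q \<longleftrightarrow> (\<exists>\<kappa>. \<kappa> \<noteq> 0 \<and> h = Polynomial.smult \<kappa> g)"
proof
  assume "is_a_gcd h p q"
  then have "g dvd h" "h dvd g" using gcd by (auto simp: is_a_gcd_def)
  then show "\<exists>\<kappa>. \<kappa> \<noteq> 0 \<and> h = Polynomial.smult \<kappa> g"
    using dvd_antisym_poly g_nz by blast
next
  assume "\<exists>\<kappa>. \<kappa> \<noteq> 0 \<and> h = Polynomial.smult \<kappa> g"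
  then show "is_a_gcd h p q"
    using gcd by (auto simp: is_a_gcd_def smult_dvd_iff dvd_smult)
qed

text \<open>For equal degrees the first two rows are \<open>Q + c0 P\<close> and \<open>t P\<close>,
  which is one more step applied to \<open>(P, Q)\<close>. For smaller degree of \<open>q\<close>
  the value \<open>c0\<close> is 0.\<close>

lemma H_mat_sfrac_step:
  "inf_mat_eq (H_mat p q)
    (let w = if degree q < degree p then (rev_poly n p, rev_poly n (q - Polynomial.smult c0 p))
       else sfrac_step c0 (rev_poly n p, rev_poly n (q - Polynomial.smult c0 p))
     in interlaced (fps_of_poly (fst w)) (fps_of_poly (snd w)))"
proof -
  have "c0 = 0" if "degree q < degree p"
    using that by (simp add: c0 deg_p coeff_eq_0)
  then show ?thesis
    using H_mat_interlaced[of p q]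
    by (auto simp: deg_p rev_poly_diff rev_poly_smult fps_of_poly_pCons mult.commute[of _ fps_X])
qed

lemma H_factorization_iff:
  "(\<exists>h. H_factorization p q k c h) \<longleftrightarrow> c 0 = c0 \<and> sfrac_coeffs (map c [1..<Suc k])"
proof -
  define cs where "cs = map c [1..<Suc k]"
  have nz: "(\<forall>j\<in>{1..k}. c j \<noteq> 0) \<longleftrightarrow> 0 \<notin> set cs"
    by (auto simp: cs_def Bex_def image_iff)
  let ?P = "rev_poly n p" and ?Q = "rev_poly n (q - Polynomial.smult c0 p)"
  let ?js = "[(if degree q < degree p then 1 else 0)..<Suc k]"
  have fact: "inf_mat_eq (H_mat p q) (foldr (\<lambda>j M. inf_mat_mult (J_mat (c j)) M) ?js
        (inf_mat_mult H01_mat (toeplitz_mat h))) \<longleftrightarrow>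
      sfrac_pair cs (rev_poly (degree h) h) = (?P, ?Q)" (is "inf_mat_eq _ ?M \<longleftrightarrow> _") if "c 0 = c0" for h
  proof -
    define v where "v = foldr sfrac_step (map c ?js) (rev_poly (degree h) h, 0)"
    define u where "u = (if degree q < degree p then (?P, ?Q) else sfrac_step c0 (?P, ?Q))"
    have M: "inf_mat_eq ?M (interlaced (fps_of_poly (fst v)) (fps_of_poly (snd v)))"
      unfolding v_def using inf_mat_mult_H01_toeplitz[of h] by (intro foldr_J_interlaced) simp
    have H: "inf_mat_eq (H_mat p q) (interlaced (fps_of_poly (fst u)) (fps_of_poly (snd u)))"
      using H_mat_sfrac_step by (simp add: u_def Let_def)
    have "inf_mat_eq (H_mat p q) ?M \<longleftrightarrow>
        inf_mat_eq (interlaced (fps_of_poly (fst u)) (fps_of_poly (snd u)))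
          (interlaced (fps_of_poly (fst v)) (fps_of_poly (snd v)))"
      using M H inf_mat_eq_sym inf_mat_eq_trans by meson
    also have "\<dots> \<longleftrightarrow> u = v"
      by (simp only: inf_mat_eq_interlaced_iff fps_of_poly_eq_iff prod_eq_iff)
    also have "\<dots> \<longleftrightarrow> sfrac_pair cs (rev_poly (degree h) h) = (?P, ?Q)"
    proof (cases "degree q < degree p")
      case True
      then show ?thesis by (auto simp: u_def v_def cs_def sfrac_pair_def)
    next
      case False
      then have "v = sfrac_step c0 (sfrac_pair cs (rev_poly (degree h) h))"
        unfolding v_def cs_def sfrac_pair_def using that
        by (simp add: upt_conv_Cons del: upt_Suc)
      \<comment> \<open>A step is injective, so the extra factor \<open>J(c0)\<close> can be
        cancelled.\<close>
      moreover have "sfrac_step c0 a = sfrac_step c0 b \<longleftrightarrow> a = b" for a b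
        by (auto simp: sfrac_step_def case_prod_beta prod_eq_iff)
      ultimately show ?thesis using False by (auto simp: u_def simp del: sfrac_step_Pair)
    qed
    finally show ?thesis .
  qed
  \<comment> \<open>Any admissible \<open>h\<close> is a multiple of \<open>g\<close>; linearity of
    the steps lets the reversal of \<open>g\<close> be cancelled on both sides, leaving only the
    scalar.\<close>
  have scaled: "sfrac_pair cs (rev_poly (degree h) h) = (?P, ?Q) \<longleftrightarrow> sfrac_pair cs [:\<kappa>:] = base"
    if "\<kappa> \<noteq> 0" "h = Polynomial.smult \<kappa> g" for \<kappa> h
  proof -
    have "rev_poly (degree h) h = [:\<kappa>:] * rev_poly (n - r) g"
      using that deg_g by (simp add: rev_poly_smult)
    then show ?thesis
      using sfrac_pair_mult[of cs "[:\<kappa>:]" "rev_poly (n - r) g"] rev_g_nz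
      by (auto simp add: rev_p rev_diff prod_eq_iff)
  qed
  show ?thesis
    unfolding H_factorization_def deg_p[symmetric, THEN arg_cong[of _ _ "coeff q"]] nz
      sfrac_coeffs_def cs_def[symmetric]
    using fact scaled is_a_gcd_iff deg_p c0 by (smt (verit))
qed

section \<open>Hankel determinants as minors of the reduced pair\<close>

lemma laurent_reduced:
  obtains F where "F * fps_of_poly (fst base) = fps_of_poly (snd base)"
    "fps_nth F 0 = 0" "\<And>m. fps_nth F (Suc m) = s (int m)"
proof -
  define S where "S = Abs_fps (\<lambda>m. s (int m - 1))"
  define F where "F = S - fps_const c0"
  define G where "G = fps_of_poly (rev_poly (n - r) g)"
  have "S * fps_of_poly (rev_poly n p) = fps_of_poly (rev_poly n q)"
    unfolding S_def by (rule laurent_at_infinity_ratfun[OF s p_nz deg_p deg_q])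
  then have "F * fps_of_poly (rev_poly n p) = fps_of_poly (rev_poly n (q - Polynomial.smult c0 p))"
    by (simp add: F_def rev_poly_diff rev_poly_smult fps_of_poly_diff fps_of_poly_smult algebra_simps)
  then have "G * (F * fps_of_poly (fst base)) = G * fps_of_poly (snd base)"
    by (simp add: rev_p rev_diff G_def fps_of_poly_mult mult_ac)
  moreover have "G \<noteq> 0" using rev_g_nz by (simp add: G_def)
  ultimately have F: "F * fps_of_poly (fst base) = fps_of_poly (snd base)" by simp
  have "fps_nth F 0 * coeff f1 r = 0"
    using arg_cong[OF F, of "\<lambda>f. fps_nth f 0"] fst_base_0(1) snd_base_0 by (simp add: poly_0_coeff_0)
  then have "fps_nth F 0 = 0" using fst_base_0(2) by simp
  moreover have "fps_nth F (Suc m) = s (int m)" for m by (simp add: F_def S_def)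
  ultimately show thesis using F that by blast
qed

text \<open>The reduced pair is \<open>(1, F)\<close> times its first component, with
  \<open>F\<close> the expansion of \<open>R - c0\<close>. Its minors are thus those of
  \<open>(1, F)\<close> times powers of the leading coefficient of \<open>f1\<close>.\<close>

lemma pair_minor_base:
  "pair_minor base (2 * j) = coeff f1 r ^ (2 * j) * hankel_det s j"
  "pair_minor base (Suc (2 * j)) = coeff f1 r ^ Suc (2 * j) * ((-1) ^ j * hankel_det_hat s j)"
proof -
  obtain F where F: "F * fps_of_poly (fst base) = fps_of_poly (snd base)"
    "fps_nth F 0 = 0" "\<And>m. fps_nth F (Suc m) = s (int m)"
    using laurent_reduced by blast
  have "pair_minor base m = coeff f1 r ^ m * leading_minor (interlaced 1 F) m" for m
    using leading_minor_interlaced_mult[of 1 "fps_of_poly (fst base)" F m] fst_base_0(1)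
    by (simp add: pair_minor_def F(1) poly_0_coeff_0)
  then show "pair_minor base (2 * j) = coeff f1 r ^ (2 * j) * hankel_det s j"
    "pair_minor base (Suc (2 * j)) = coeff f1 r ^ Suc (2 * j) * ((-1) ^ j * hankel_det_hat s j)"
    using leading_minor_interlaced_one[OF F(2,3), of j] by simp_all
qed

lemma hankel_conditions_iff_minors:
  assumes "is_pole R 0 \<longleftrightarrow> poly f1 0 = 0"
  shows "hankel_conditions R s r \<longleftrightarrow> (\<forall>m. pair_minor base m \<noteq> 0 \<longleftrightarrow> m \<le> Suc k)"
proof -
  have D: "pair_minor base (2 * j) \<noteq> 0 \<longleftrightarrow> hankel_det s j \<noteq> 0"
    and E: "pair_minor base (Suc (2 * j)) \<noteq> 0 \<longleftrightarrow> hankel_det_hat s j \<noteq> 0" for j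
    using fst_base_0(2) by (simp_all add: pair_minor_base)
  have "(\<forall>m. pair_minor base m \<noteq> 0 \<longleftrightarrow> m \<le> Suc k) \<longleftrightarrow>
      (\<forall>j. (hankel_det s j \<noteq> 0 \<longleftrightarrow> 2 * j \<le> Suc k) \<and> (hankel_det_hat s j \<noteq> 0 \<longleftrightarrow> 2 * j \<le> k))"
  proof (rule iffI; rule allI)
    fix j assume "\<forall>m. pair_minor base m \<noteq> 0 \<longleftrightarrow> m \<le> Suc k"
    then show "(hankel_det s j \<noteq> 0 \<longleftrightarrow> 2 * j \<le> Suc k) \<and> (hankel_det_hat s j \<noteq> 0 \<longleftrightarrow> 2 * j \<le> k)"
      unfolding D[symmetric] E[symmetric] by simp
  next
    fix m assume *: "\<forall>j. (hankel_det s j \<noteq> 0 \<longleftrightarrow> 2 * j \<le> Suc k) \<and>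
        (hankel_det_hat s j \<noteq> 0 \<longleftrightarrow> 2 * j \<le> k)"
    have "m = 2 * (m div 2) \<or> m = Suc (2 * (m div 2))" by linarith
    then show "pair_minor base m \<noteq> 0 \<longleftrightarrow> m \<le> Suc k"
      using * D E by (metis Suc_le_mono)
  qed
  also have "\<dots> \<longleftrightarrow> hankel_conditions R s r"
  proof -
    \<comment> \<open>Only the index \<open>2 r + 1\<close>, belonging to the shifted determinant of
      order \<open>r\<close>, depends on whether 0 is a pole.\<close>
    have k': "2 * j \<le> Suc k \<longleftrightarrow> j \<le> r"
      "2 * j \<le> k \<longleftrightarrow> (j < r \<or> (j = r \<and> poly f1 0 \<noteq> 0))" for j
      using k r by (auto split: if_splits)
    have zero: "hankel_det s 0 \<noteq> 0" "hankel_det_hat s 0 \<noteq> 0"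
      by (simp_all add: hankel_det_def hankel_det_hat_def)
    show ?thesis
      unfolding hankel_conditions_def assms k'
    proof (rule iffI, goal_cases)
      case 1
      show ?case
      proof (intro conjI ballI allI impI)
        fix j
        note j = 1[rule_format, of j]
        show "hankel_det s j \<noteq> 0" if "j \<in> {1..r}" using j that by simp
        show "hankel_det_hat s j \<noteq> 0" if "j \<in> {1..r - 1}"
        proof -
          have "1 \<le> j" "j \<le> r - 1" using that by simp_all
          then have "j < r" using r by linarith
          then show ?thesis using j by simp
        qed
        show "hankel_det s j = 0" "hankel_det_hat s j = 0" if "r < j" using j that by simp_all
        show "hankel_det_hat s r = 0 \<longleftrightarrow> poly f1 0 = 0" using 1[rule_format, of r] by simp
      qed
    next
      case hyp: 2
      show ?case
      proof
        fix j
        consider "j = 0" | "j \<in> {1..r - 1}" | "j = r" | "j > r" 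
          by (cases "j = 0 \<or> j = r \<or> r < j") auto
        then show "(hankel_det s j \<noteq> 0 \<longleftrightarrow> j \<le> r) \<and>
            (hankel_det_hat s j \<noteq> 0 \<longleftrightarrow> j < r \<or> j = r \<and> poly f1 0 \<noteq> 0)"
        proof cases
          case 2
          then have "1 \<le> j" "j \<le> r - 1" by simp_all
          then have "j \<in> {1..r}" "j < r" using r by (simp, linarith)
          then show ?thesis using hyp 2 by (simp only:) simp
        next
          case 3
          have "r \<in> {1..r}" using r by simp
          then show ?thesis using hyp 3 by (simp only:) simp
        qed (use hyp zero r in \<open>simp_all\<close>)
      qed
    qed
  qed
  finally show ?thesis by simp
qed

lemma sfrac_coeffs_exists_iff:
  "(\<exists>cs. length cs = k \<and> sfrac_coeffs cs) \<longleftrightarrow> (\<forall>m. pair_minor base m \<noteq> 0 \<longleftrightarrow> m \<le> Suc k)"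
proof
  assume "\<exists>cs. length cs = k \<and> sfrac_coeffs cs"
  then obtain cs \<kappa> where cs: "length cs = k" "0 \<notin> set cs" "\<kappa> \<noteq> 0" "sfrac_pair cs [:\<kappa>:] = base"
    by (auto simp: sfrac_coeffs_def)
  then show "\<forall>m. pair_minor base m \<noteq> 0 \<longleftrightarrow> m \<le> Suc k"
    using pair_minor_sfrac_pair[OF cs(2), of "[:\<kappa>:]"] by simp
next
  assume minors: "\<forall>m. pair_minor base m \<noteq> 0 \<longleftrightarrow> m \<le> Suc k"
  obtain y where y: "snd base = pCons 0 y"
    using snd_base_0 by (metis coeff_pCons_0 pCons_cases poly_0_coeff_0)
  then have base: "(fst base, pCons 0 y) = base" by (metis prod.collapse)
  have "\<exists>cs \<kappa>. length cs = k \<and> 0 \<notin> set cs \<and> \<kappa> \<noteq> 0 \<and>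
      sfrac_pair cs [:\<kappa>:] = (fst base, pCons 0 y)"
  proof (rule sfrac_pair_exists)
    \<comment> \<open>If \<open>f1\<close> vanishes at 0, its reversal loses the top coefficient;
      this accounts for the odd value of \<open>k\<close>.\<close>
    let ?a = "if poly f1 0 = 0 then r else Suc r"
    show "coeff (fst base) i = 0" if "?a \<le> i" for i
      using that by (auto simp: base_def coeff_rev_poly poly_0_coeff_0 split: if_splits)
    show "coeff y i = 0" if "r \<le> i" for i
    proof -
      have "coeff y i = coeff (snd base) (Suc i)" by (simp add: y)
      then show ?thesis using that by (simp add: base_def coeff_rev_poly)
    qed
    show "?a + r = Suc k" "r \<le> ?a" "?a \<le> Suc r" using k r by (auto split: if_splits)
    show "pair_minor (fst base, pCons 0 y) j \<noteq> 0" if "j \<le> Suc k" for j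
      using minors that unfolding base by blast
  qed
  then show "\<exists>cs. length cs = k \<and> sfrac_coeffs cs"
    unfolding base sfrac_coeffs_def by blast
qed

section \<open>Regularity, the degree of \<open>q\<close>, and the coefficient formulas\<close>

lemma regular_euclid_iff:
  "regular_euclid (p \<circ>\<^sub>p monom 1 2)
      (monom 1 1 * (q \<circ>\<^sub>p monom 1 2) - Polynomial.smult c0 (monom 1 1 * (p \<circ>\<^sub>p monom 1 2))) \<longleftrightarrow>
    (\<exists>cs. length cs = k \<and> sfrac_coeffs cs)"
proof -
  define G where "G = g \<circ>\<^sub>p monom 1 2"
  have "monom 1 1 * (q \<circ>\<^sub>p monom 1 2) - Polynomial.smult c0 (monom 1 1 * (p \<circ>\<^sub>p monom 1 2)) =
      monom 1 1 * ((q - Polynomial.smult c0 p) \<circ>\<^sub>p monom 1 2)"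
    by (simp add: pcompose_diff pcompose_smult right_diff_distrib)
  also have "\<dots> = G * (monom 1 1 * (f2 \<circ>\<^sub>p monom 1 2))"
    unfolding q by (simp add: pcompose_mult G_def mult_ac)
  finally have "monom 1 1 * (q \<circ>\<^sub>p monom 1 2) - Polynomial.smult c0 (monom 1 1 * (p \<circ>\<^sub>p monom 1 2)) =
      G * (monom 1 1 * (f2 \<circ>\<^sub>p monom 1 2))" .
  moreover have "p \<circ>\<^sub>p monom 1 2 = G * (f1 \<circ>\<^sub>p monom 1 2)"
    by (simp add: p pcompose_mult G_def)
  moreover have "G \<noteq> 0"
    using g_nz by (simp add: G_def pcompose_eq_0_iff degree_monom_eq)
  ultimately have "regular_euclid (p \<circ>\<^sub>p monom 1 2)
      (monom 1 1 * (q \<circ>\<^sub>p monom 1 2) - Polynomial.smult c0 (monom 1 1 * (p \<circ>\<^sub>p monom 1 2))) \<longleftrightarrow>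
      regular_euclid (f1 \<circ>\<^sub>p monom 1 2) (monom 1 1 * (f2 \<circ>\<^sub>p monom 1 2))"
    by (simp add: regular_euclid_def euclid_quotients_mult)
  also have "\<dots> \<longleftrightarrow> (\<exists>cs. length cs = k \<and> sfrac_coeffs cs)"
    using regular_euclid_iff_sfrac_pair[OF cop deg_f1 deg_f2 k]
    by (auto simp: sfrac_coeffs_def base_def)
  finally show ?thesis .
qed

text \<open>If \<open>degree q < n - 1\<close>, then \<open>c0 = 0\<close>. But the second minor
  gives \<open>s 0 \<noteq> 0\<close>, so \<open>f2\<close> has degree exactly \<open>r - 1\<close>
  and \<open>q = g f2\<close> degree \<open>n - 1\<close>.\<close>

lemma degree_q_ge:
  assumes "sfrac_coeffs cs" "length cs = k"
  shows "degree q \<ge> n - 1"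
proof (rule ccontr)
  assume *: "\<not> degree q \<ge> n - 1"
  then have "c0 = 0" using deg_q by (simp add: c0 coeff_eq_0)
  have "\<forall>m. pair_minor base m \<noteq> 0 \<longleftrightarrow> m \<le> Suc k"
    using sfrac_coeffs_exists_iff assms by blast
  then have "pair_minor base (2 * 1) \<noteq> 0" using k_pos by simp
  then have "s 0 \<noteq> 0"
    unfolding pair_minor_base by (simp add: hankel_det_def det_single)
  moreover obtain F where F: "F * fps_of_poly (fst base) = fps_of_poly (snd base)"
    "fps_nth F 0 = 0" "\<And>m. fps_nth F (Suc m) = s (int m)"
    using laurent_reduced by blast
  have "coeff (snd base) 1 = s 0 * coeff f1 r"
    using arg_cong[OF F(1), of "\<lambda>f. fps_nth f 1"] F(2) F(3)[of 0] fst_base_0(1)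
    by (simp add: fps_mult_nth poly_0_coeff_0)
  ultimately have "coeff (snd base) 1 \<noteq> 0" using fst_base_0(2) by simp
  then have "coeff f2 (r - 1) \<noteq> 0" using r by (simp add: base_def coeff_rev_poly)
  then have "degree f2 = r - 1" "f2 \<noteq> 0" using deg_f2 le_degree[of f2 "r - 1"] by auto
  then have "degree (g * f2) = n - r + (r - 1)" using g_nz deg_g by (simp add: degree_mult_eq)
  then have "degree q = n - 1" using q \<open>c0 = 0\<close> deg_g r by simp
  then show False using * by simp
qed

text \<open>The same coefficients build the reduced pair from \<open>\<kappa>\<close> and the full
  pair from \<open>\<kappa>\<close> times the reversal of \<open>g\<close>. The first yields the
  Hankel formulas, the second those in the minors of \<open>H(p, q)\<close>.\<close>

lemma coefficient_minors:
  assumes "sfrac_coeffs (map c [1..<Suc k])" "i < k"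
  shows "c (Suc i) = (pair_minor base (Suc i))\<^sup>2 / (pair_minor base i * pair_minor base (Suc (Suc i)))"
    and "\<eta> = pair_minor (rev_poly n p, rev_poly n (q - Polynomial.smult c0 p)) \<Longrightarrow>
      c (Suc i) = (\<eta> (Suc i))\<^sup>2 / (\<eta> i * \<eta> (Suc (Suc i)))"
proof -
  define cs where "cs = map c [1..<Suc k]"
  have i: "cs ! i = c (Suc i)" "i < length cs"
    using assms(2) by (simp_all add: cs_def del: upt_Suc)
  obtain \<kappa> where cs: "0 \<notin> set cs" "\<kappa> \<noteq> 0" "sfrac_pair cs [:\<kappa>:] = base"
    using assms(1) by (auto simp: sfrac_coeffs_def cs_def)
  show "c (Suc i) = (pair_minor base (Suc i))\<^sup>2 / (pair_minor base i * pair_minor base (Suc (Suc i)))"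
    using sfrac_pair_coefficient[OF cs(1) _ i(2), of "[:\<kappa>:]"] cs i by simp
  have "sfrac_pair cs ([:\<kappa>:] * rev_poly (n - r) g) =
      (rev_poly n p, rev_poly n (q - Polynomial.smult c0 p))"
    unfolding sfrac_pair_mult cs(3) rev_p rev_diff by (simp only: mult.commute)
  moreover have "poly ([:\<kappa>:] * rev_poly (n - r) g) 0 \<noteq> 0" using cs(2) rev_g_0 by simp
  ultimately show "c (Suc i) = (\<eta> (Suc i))\<^sup>2 / (\<eta> i * \<eta> (Suc (Suc i)))"
    if "\<eta> = pair_minor (rev_poly n p, rev_poly n (q - Polynomial.smult c0 p))"
    using sfrac_pair_coefficient[OF cs(1) _ i(2), of "[:\<kappa>:] * rev_poly (n - r) g"] i that by metis
qed

end

section \<open>Reduction to lowest terms and the equivalence of the conditions\<close>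

lemma reduced_polys_exist:
  fixes p q :: "complex poly"
  assumes "p \<noteq> 0"
  obtains g f h where "p = g * f" "q = g * h" "g \<noteq> 0" "f \<noteq> 0" "is_a_gcd g p q"
    "\<And>z. poly f z = 0 \<Longrightarrow> poly h z \<noteq> 0"
proof -
  have g: "gcd p q \<noteq> 0" using assms by simp
  obtain f h where fh: "p = f * gcd p q" "q = h * gcd p q" "coprime f h"
    using gcd_coprime_exists[OF g] by metis
  have root: "poly h z \<noteq> 0" if "poly f z = 0" for z
  proof
    assume "poly h z = 0"
    then have "is_unit [:-z, 1:]"
      using that fh(3) by (auto simp: poly_eq_0_iff_dvd intro: coprime_common_divisor)
    then show False by (simp add: is_unit_poly_iff)
  qed
  show thesis
  proof (rule that[of "gcd p q" f h])
    show "p = gcd p q * f" "q = gcd p q * h" using fh(1,2) by (simp_all only: mult.commute)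
    show "f \<noteq> 0" using fh(1) assms by auto
    show "is_a_gcd (gcd p q) p q" by (simp add: is_a_gcd_def)
  qed (use g root in auto)
qed

theorem theorem1p46:
  fixes p q :: "complex poly" and n r k :: nat and R :: "complex \<Rightarrow> complex"
    and s :: "int \<Rightarrow> complex" and \<eta> :: "nat \<Rightarrow> complex"
  assumes deg_p: "degree p = n" and p_nz: "p \<noteq> 0" and deg_q: "degree q \<le> n"
    and R_def: "R = ratfun q p"
    and s: "laurent_at_infinity R s"
    and r_def: "pole_count R = r" and r: "1 \<le> r" "r \<le> n"
    and k_def: "k = (if is_pole R 0 then 2 * r - 1 else 2 * r)"
    and eta_def: "\<eta> = leading_minor (H_mat p q)"
  shows
    "(hankel_conditions R s r \<longleftrightarrow> (\<exists>c. stieltjes_expansion p q k c)) \<and>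
    (hankel_conditions R s r \<longleftrightarrow>
      regular_euclid (p \<circ>\<^sub>p monom 1 2)
        (monom 1 1 * (q \<circ>\<^sub>p monom 1 2)
          - Polynomial.smult (coeff q n / coeff p n) (monom 1 1 * (p \<circ>\<^sub>p monom 1 2))) \<and>
      degree q \<ge> n - 1) \<and>
    (hankel_conditions R s r \<longleftrightarrow> (\<exists>c g. H_factorization p q k c g)) \<and>
    (hankel_conditions R s r \<longrightarrow> (\<forall>c. stieltjes_expansion p q k c \<or> (\<exists>g. H_factorization p q k c g) \<longrightarrow>
      (\<forall>j\<in>{1..r}. c (2 * j - 1) =
         (hankel_det_hat s (j - 1))\<^sup>2 / (hankel_det s (j - 1) * hankel_det s j)) \<and>
      (\<forall>j\<in>{1..k div 2}. c (2 * j) =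
         - ((hankel_det s j)\<^sup>2 / (hankel_det_hat s (j - 1) * hankel_det_hat s j))) \<and>
      (if degree q < degree p then
         (\<forall>j\<in>{1..r}. c (2 * j - 1) = (\<eta> (2 * j - 1))\<^sup>2 / (\<eta> (2 * j - 2) * \<eta> (2 * j))) \<and>
         (\<forall>j\<in>{1..k div 2}. c (2 * j) = (\<eta> (2 * j))\<^sup>2 / (\<eta> (2 * j - 1) * \<eta> (2 * j + 1)))
       else
         (\<forall>j\<in>{1..r}. c (2 * j - 1) = (\<eta> (2 * j))\<^sup>2 / (\<eta> (2 * j - 1) * \<eta> (2 * j + 1))) \<and>
         (\<forall>j\<in>{0..k div 2}. c (2 * j) = (\<eta> (2 * j + 1))\<^sup>2 / (\<eta> (2 * j) * \<eta> (2 * j + 2))))))"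
proof -
  define c0 where "c0 = coeff q n / coeff p n"
  obtain g f1 h where red: "p = g * f1" "q = g * h" "g \<noteq> 0" "f1 \<noteq> 0" "is_a_gcd g p q"
    "\<And>z. poly f1 z = 0 \<Longrightarrow> poly h z \<noteq> 0"
    using reduced_polys_exist[OF p_nz] by metis
  \<comment> \<open>At a root of \<open>f1\<close> the subtracted multiple vanishes, so
    \<open>f2\<close> inherits from \<open>h\<close> that it has no root in common with
    \<open>f1\<close>.\<close>
  define f2 where "f2 = h - Polynomial.smult c0 f1"
  have near: "eventually (\<lambda>w. R w = ratfun h f1 w) (at z)" for z
    unfolding R_def red(1,2) by (rule ratfun_reduced[OF red(3)])
  have deg_f1: "degree f1 = r"
    using pole_count_cong[OF near] pole_count_ratfun[OF red(4,6)] r_def by simp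
  have pole: "is_pole R 0 \<longleftrightarrow> poly f1 0 = 0"
    using is_pole_cong[OF near refl] is_pole_ratfun_iff[OF red(4,6)] by simp
  interpret reduced_fraction p q g f1 f2 c0 n r k s
  proof
    show "q - Polynomial.smult c0 p = g * f2"
      unfolding red(1,2) f2_def by (simp add: right_diff_distrib)
    show "poly f2 z \<noteq> 0" if "poly f1 z = 0" for z
      using red(6)[OF that] that by (simp add: f2_def)
    show "k = (if poly f1 0 = 0 then 2 * r - 1 else 2 * r)" using k_def pole by simp
    show "laurent_at_infinity (ratfun q p) s" using s R_def by simp
  qed (use red deg_p deg_q c0_def deg_f1 r in simp_all)
  have hankel: "hankel_conditions R s r \<longleftrightarrow> (\<exists>cs. length cs = k \<and> sfrac_coeffs cs)"
    using hankel_conditions_iff_minors[OF pole] sfrac_coeffs_exists_iff by simp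
  have ex: "(\<exists>cs. length cs = k \<and> sfrac_coeffs cs) \<longleftrightarrow>
      (\<exists>c. c 0 = c0 \<and> sfrac_coeffs (map c [1..<Suc k]))"
  proof
    assume "\<exists>cs. length cs = k \<and> sfrac_coeffs cs"
    then obtain cs where cs: "length cs = k" "sfrac_coeffs cs" by blast
    define c where "c = (\<lambda>j. if j = 0 then c0 else cs ! (j - 1))"
    have "map c [1..<Suc k] = cs"
      using cs(1) by (intro nth_equalityI) (simp_all add: c_def del: upt_Suc)
    then show "\<exists>c. c 0 = c0 \<and> sfrac_coeffs (map c [1..<Suc k])"
      using cs(2) by (intro exI[of _ c]) (simp add: c_def)
  next
    assume "\<exists>c. c 0 = c0 \<and> sfrac_coeffs (map c [1..<Suc k])"
    then obtain c where "sfrac_coeffs (map c [1..<Suc k])" by blast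
    then show "\<exists>cs. length cs = k \<and> sfrac_coeffs cs"
      by (intro exI[of _ "map c [1..<Suc k]"]) simp
  qed
  have formulas: "(\<forall>j\<in>{1..r}. c (2 * j - 1) =
         (hankel_det_hat s (j - 1))\<^sup>2 / (hankel_det s (j - 1) * hankel_det s j)) \<and>
      (\<forall>j\<in>{1..k div 2}. c (2 * j) =
         - ((hankel_det s j)\<^sup>2 / (hankel_det_hat s (j - 1) * hankel_det_hat s j))) \<and>
      (if degree q < degree p then
         (\<forall>j\<in>{1..r}. c (2 * j - 1) = (\<eta> (2 * j - 1))\<^sup>2 / (\<eta> (2 * j - 2) * \<eta> (2 * j))) \<and>
         (\<forall>j\<in>{1..k div 2}. c (2 * j) = (\<eta> (2 * j))\<^sup>2 / (\<eta> (2 * j - 1) * \<eta> (2 * j + 1)))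
       else
         (\<forall>j\<in>{1..r}. c (2 * j - 1) = (\<eta> (2 * j))\<^sup>2 / (\<eta> (2 * j - 1) * \<eta> (2 * j + 1))) \<and>
         (\<forall>j\<in>{0..k div 2}. c (2 * j) = (\<eta> (2 * j + 1))\<^sup>2 / (\<eta> (2 * j) * \<eta> (2 * j + 2))))"
    if c: "c 0 = c0" "sfrac_coeffs (map c [1..<Suc k])" for c
  proof -
    define \<theta> where "\<theta> = pair_minor (rev_poly n p, rev_poly n (q - Polynomial.smult c0 p))"
    define a where "a = coeff f1 r"
    have a: "a \<noteq> 0" using fst_base_0(2) by (simp add: a_def)
    note base_minor = coefficient_minors(1)[OF c(2)]
    note \<theta>_minor = coefficient_minors(2)[OF c(2) _ \<theta>_def]
    have odd_lt: "2 * i < k" if "Suc i \<le> r" for i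
      using that k by (auto split: if_splits)
    have even_lt: "Suc (2 * i) < k" if "Suc i \<le> k div 2" for i
      using that by linarith
    have D_odd: "c (Suc (2 * i)) = (hankel_det_hat s i)\<^sup>2 / (hankel_det s i * hankel_det s (Suc i))"
      if "Suc i \<le> r" for i
    proof -
      have "c (Suc (2 * i)) = (a ^ Suc (2 * i) * ((-1) ^ i * hankel_det_hat s i))\<^sup>2 /
          (a ^ (2 * i) * hankel_det s i * (a ^ (2 * Suc i) * hankel_det s (Suc i)))"
        using base_minor[OF odd_lt[OF that]] pair_minor_base(1)[of i] pair_minor_base(2)[of i]
          pair_minor_base(1)[of "Suc i"] by (simp add: a_def)
      also have "\<dots> = (a ^ Suc (2 * i))\<^sup>2 * (hankel_det_hat s i)\<^sup>2 /
          ((a ^ Suc (2 * i))\<^sup>2 * (hankel_det s i * hankel_det s (Suc i)))"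
        by (simp add: power_mult_distrib power2_eq_square mult_ac flip: power_mult)
      finally show ?thesis using a by simp
    qed
    have D_even: "c (Suc (Suc (2 * i))) =
        - ((hankel_det s (Suc i))\<^sup>2 / (hankel_det_hat s i * hankel_det_hat s (Suc i)))"
      if "Suc i \<le> k div 2" for i
    proof -
      have "c (Suc (Suc (2 * i))) = (a ^ (2 * Suc i) * hankel_det s (Suc i))\<^sup>2 /
          (a ^ Suc (2 * i) * ((-1) ^ i * hankel_det_hat s i) *
            (a ^ Suc (2 * Suc i) * ((-1) ^ Suc i * hankel_det_hat s (Suc i))))"
        using base_minor[OF even_lt[OF that]] pair_minor_base(2)[of i]
          pair_minor_base(1)[of "Suc i"] pair_minor_base(2)[of "Suc i"] by (simp add: a_def)
      \<comment> \<open>The two consecutive signs multiply to \<open>-1\<close>, whence the minus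
        sign; the powers of \<open>a\<close> balance.\<close>
      also have "\<dots> = (a ^ (2 * Suc i))\<^sup>2 * (hankel_det s (Suc i))\<^sup>2 /
          ((a ^ (2 * Suc i))\<^sup>2 * - (hankel_det_hat s i * hankel_det_hat s (Suc i)))"
        by (simp add: power_mult_distrib power2_eq_square mult_ac flip: power_mult)
      finally show ?thesis using a by simp
    qed
    have less: "\<eta> = \<theta>" if "degree q < degree p"
      using leading_minor_cong[OF H_mat_sfrac_step] that
      by (auto simp: eta_def \<theta>_def pair_minor_def fun_eq_iff)
    \<comment> \<open>For equal degrees \<open>H(p, q)\<close> contains one more step, with constant
      term \<open>c0 a_0 = b_0\<close>, so the minors shift by one and acquire this factor.\<close>
    have eq: "\<eta> (Suc m) = coeff q n * \<theta> m" if "\<not> degree q < degree p" for m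
    proof -
      have "\<eta> (Suc m) =
          pair_minor (sfrac_step c0 (rev_poly n p, rev_poly n (q - Polynomial.smult c0 p))) (Suc m)"
        using leading_minor_cong[OF H_mat_sfrac_step, of "Suc m"] that
        by (simp add: eta_def pair_minor_def Let_def del: sfrac_step_Pair)
      also have "\<dots> = coeff q n * \<theta> m"
        unfolding pair_minor_sfrac_step using lead_p
        by (simp add: \<theta>_def poly_rev_poly_0 c0_def)
      finally show ?thesis .
    qed
    have lead_q: "coeff q n \<noteq> 0" if "\<not> degree q < degree p"
    proof -
      have "degree q = n" using that deg_p deg_q by simp
      then show ?thesis using r deg_g(2) by auto
    qed
    have eq_minor: "c (Suc i) = (\<eta> (Suc (Suc i)))\<^sup>2 / (\<eta> (Suc i) * \<eta> (Suc (Suc (Suc i))))"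
      if "\<not> degree q < degree p" "i < k" for i
    proof -
      have "(\<eta> (Suc (Suc i)))\<^sup>2 / (\<eta> (Suc i) * \<eta> (Suc (Suc (Suc i)))) =
          (coeff q n)\<^sup>2 * (\<theta> (Suc i))\<^sup>2 / ((coeff q n)\<^sup>2 * (\<theta> i * \<theta> (Suc (Suc i))))"
        by (simp add: eq[OF that(1)] power_mult_distrib) (simp add: power2_eq_square mult_ac)
      then show ?thesis using lead_q[OF that(1)] \<theta>_minor[OF that(2)] by simp
    qed
    \<comment> \<open>The minors of order 1 and 2 are \<open>b_0\<close> and \<open>b_0 a_0\<close>,
      so the quotient is \<open>b_0 / a_0\<close>.\<close>
    have eq_0: "c 0 = (\<eta> (Suc 0))\<^sup>2 / (\<eta> 0 * \<eta> (Suc (Suc 0)))" if "\<not> degree q < degree p"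
    proof -
      have "\<theta> 0 = 1" "\<theta> (Suc 0) = coeff p n" "\<eta> 0 = 1"
        by (simp_all add: \<theta>_def pair_minor_1 poly_rev_poly_0 eta_def)
      then show ?thesis
        using eq[OF that, of 0] eq[OF that, of "Suc 0"] lead_q[OF that]
        by (simp add: c(1) c0_def power2_eq_square)
    qed
    have idx1: "(\<forall>j\<in>{1..l}. P j) \<longleftrightarrow> (\<forall>i. Suc i \<le> l \<longrightarrow> P (Suc i))"
      for l and P :: "nat \<Rightarrow> bool"
    proof (intro iffI ballI allI impI)
      fix j assume *: "\<forall>i. Suc i \<le> l \<longrightarrow> P (Suc i)" and "j \<in> {1..l}"
      then show "P j" by (cases j) auto
    qed simp
    have idx0: "(\<forall>j\<in>{0..l}. P j) \<longleftrightarrow> P 0 \<and> (\<forall>j\<in>{1..l}. P j)" for l and P :: "nat \<Rightarrow> bool"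
      by (simp add: atLeastAtMost_insertL[of 0 l, symmetric])
    have suc: "2 * Suc i - 1 = Suc (2 * i)" "2 * Suc i - 2 = 2 * i" "2 * Suc i = Suc (Suc (2 * i))"
      "m + 1 = Suc m" "m + 2 = Suc (Suc m)" "Suc i - 1 = i" for i m :: nat
      by simp_all
    show ?thesis
      unfolding idx0 idx1 suc
      using D_odd D_even less \<theta>_minor odd_lt even_lt eq_minor eq_0 by auto
  qed
  have cond3: "degree q \<ge> n - 1" if "\<exists>cs. length cs = k \<and> sfrac_coeffs cs"
    using that degree_q_ge by blast
  show ?thesis
    unfolding hankel regular_euclid_iff[unfolded c0_def] stieltjes_expansion_iff H_factorization_iff
  proof (intro conjI)
    show "(\<exists>cs. length cs = k \<and> sfrac_coeffs cs) \<longleftrightarrow>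
        (\<exists>cs. length cs = k \<and> sfrac_coeffs cs) \<and> n - 1 \<le> degree q"
      using cond3 by blast
  qed (use ex formulas in blast)+
qed

end
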